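(* For each $N$ let $D=D_N=\mathrm{diag}(d_1,\dots,d_N)$ be a deterministic diagonal matrix with $d_i\in\{-1,+1\}$ such that $\frac1N\sum_{i=1}^N\delta_{d_i}$ converges weakly to $\frac12\delta_1+\frac12\delta_{-1}$ as $N\to\infty$, and let $O$ be Haar distributed on the orthogonal group $O(N)$. Then for all $\beta>0$ sufficiently small, $$\frac1N\log Z_N(\beta,O,D)\longrightarrow\frac14\left(\sqrt{16\beta^2+1}+\log\left(\frac{\sqrt{16\beta^2+1}-1}{8\beta^2}\right)-1\right)\qquad\text{in probability as }N\to\infty .$$
   Context: For $\beta\ge0$, $O\in O(N)$ and a diagonal matrix $D$, $Z_N(\beta,O,D)=\frac1{2^N}\sum_{\sigma\in\{-1,+1\}^N}\exp\big(\beta\,\sigma^TODO^T\sigma\big)$. This is the Random Orthogonal Model (ROM) with parameter $p=1/2$. *)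

theory Defs
  imports "HOL-Probability.Probability" "Jordan_Normal_Form.Matrix"
begin

unbundle no vec_syntax
unbundle no inner_syntax

text \<open>
  Since the dimension \<open>N\<close> tends to infinity, matrices are taken from \<open>Jordan_Normal_Form\<close>, where
  the dimension is a natural number. Indices run over \<open>0, \<dots>, N - 1\<close>.
\<close>

definition orthogonal_group :: "nat \<Rightarrow> real mat set" where
  "orthogonal_group N = {A \<in> carrier_mat N N. A * A\<^sup>T = 1\<^sub>m N \<and> A\<^sup>T * A = 1\<^sub>m N}"

text \<open>
  The Borel sigma-algebra of \<open>O(N)\<close>, that is, the trace of the Borel sigma-algebra of the space
  \<open>\<real>\<^bsup>N\<times>N\<^esup>\<close> of matrix entries. Only its measurable structure matters: as a measure,
  \<open>vimage_algebra\<close> is identically zero.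
\<close>
definition orthogonal_borel :: "nat \<Rightarrow> real mat measure" where
  "orthogonal_borel N =
     vimage_algebra (orthogonal_group N) (\<lambda>A. \<lambda>p\<in>{..<N} \<times> {..<N}. A $$ p)
       (\<Pi>\<^sub>M p\<in>{..<N} \<times> {..<N}. borel)"

text \<open>
  The normalised Haar measure of \<open>O(N)\<close> is the left-invariant Borel probability measure; as
  \<open>O(N)\<close> is compact, there is exactly one.
\<close>
definition haar_orthogonal :: "nat \<Rightarrow> real mat measure \<Rightarrow> bool" where
  "haar_orthogonal N \<mu> \<longleftrightarrow>
     prob_space \<mu> \<and> sets \<mu> = sets (orthogonal_borel N) \<and>
     (\<forall>U\<in>orthogonal_group N. distr \<mu> (orthogonal_borel N) (\<lambda>A. U * A) = \<mu>)"

definition haar_distributed :: "nat \<Rightarrow> 'a measure \<Rightarrow> ('a \<Rightarrow> real mat) \<Rightarrow> bool" where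
  "haar_distributed N M Q \<longleftrightarrow>
     Q \<in> measurable M (orthogonal_borel N) \<and>
     haar_orthogonal N (distr M (orthogonal_borel N) Q)"

definition spins :: "nat \<Rightarrow> real vec set" where
  "spins N = {\<sigma> \<in> carrier_vec N. \<forall>i<N. \<sigma> $ i \<in> {-1, 1}}"

definition partition_function :: "nat \<Rightarrow> real \<Rightarrow> real mat \<Rightarrow> real mat \<Rightarrow> real" where
  "partition_function N \<beta> Q D =
     1 / 2 ^ N * (\<Sum>\<sigma>\<in>spins N. exp (\<beta> * (\<sigma> \<bullet> ((Q * D * Q\<^sup>T) *\<^sub>v \<sigma>))))"

text \<open>
  The measure \<open>1/N \<Sum>\<^sub>i \<delta>\<^bsub>d i\<^esub>\<close>, as the image under \<open>d\<close> of the uniform distribution on the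
  indices; see \<open>measure_empirical_measure\<close> below.
\<close>
definition empirical_measure :: "nat \<Rightarrow> (nat \<Rightarrow> real) \<Rightarrow> real measure" where
  "empirical_measure N d = distr (uniform_count_measure {..<N}) borel d"

text \<open>The measure \<open>1/2 \<delta>\<^sub>1 + 1/2 \<delta>\<^bsub>-1\<^esub>\<close>.\<close>
definition symmetric_sign_measure :: "real measure" where
  "symmetric_sign_measure = distr (uniform_count_measure {1, -1}) borel (\<lambda>x. x)"

text \<open>
  Convergence in probability to a constant of random variables \<open>X n\<close>, each living on its own
  probability space \<open>M n\<close>.
\<close>
definition converges_in_prob :: "(nat \<Rightarrow> 'a measure) \<Rightarrow> (nat \<Rightarrow> 'a \<Rightarrow> real) \<Rightarrow> real \<Rightarrow> bool" where
  "converges_in_prob M X c \<longleftrightarrow>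
     (\<forall>n. X n \<in> borel_measurable (M n)) \<and>
     (\<forall>\<epsilon>>0. (\<lambda>n. measure (M n) {\<omega> \<in> space (M n). \<bar>X n \<omega> - c\<bar> > \<epsilon>}) \<longlonglongrightarrow> 0)"

lemma measure_distr_uniform_count:
  fixes f :: "'b \<Rightarrow> real"
  assumes "finite I" "B \<in> sets borel"
  shows "measure (distr (uniform_count_measure I) borel f) B = (\<Sum>i\<in>I. indicator B (f i)) / card I"
proof -
  have "measure (distr (uniform_count_measure I) borel f) B
      = measure (uniform_count_measure I) (f -` B \<inter> I)"
    using assms by (subst measure_distr) (auto simp: space_uniform_count_measure)
  also have "\<dots> = card (f -` B \<inter> I) / card I"
    using assms by (subst measure_uniform_count_measure) auto
  also have "real (card (f -` B \<inter> I)) = (\<Sum>i\<in>I. indicator B (f i))"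
  proof -
    have "(\<Sum>i\<in>I. indicator B (f i) :: real) = (\<Sum>i\<in>I. indicator (f -` B) i)"
      by (intro sum.cong) (auto simp: indicator_def)
    also have "\<dots> = card (I \<inter> f -` B)"
      using sum.inter_restrict[OF assms(1), of "\<lambda>_. 1 :: real" "f -` B"]
      by (simp add: indicator_def of_bool_def)
    finally show ?thesis by (simp add: Int_commute)
  qed
  finally show ?thesis .
qed

lemma measure_empirical_measure:
  assumes "B \<in> sets borel"
  shows "measure (empirical_measure N d) B = (\<Sum>i<N. indicator B (d i)) / N"
  using measure_distr_uniform_count[OF _ assms, of "{..<N}" d] by (simp add: empirical_measure_def)

lemma measure_symmetric_sign_measure:
  assumes "B \<in> sets borel"
  shows "measure symmetric_sign_measure B = indicator B 1 / 2 + indicator B (-1) / 2"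
  using measure_distr_uniform_count[OF _ assms, of "{1, -1}" "\<lambda>x. x"]
  by (simp add: symmetric_sign_measure_def add_divide_distrib)

lemma spins_eq_image:
  "spins N = (\<lambda>f. vec N f) ` ({..<N} \<rightarrow>\<^sub>E {-1, 1})"
proof (intro equalityI subsetI)
  fix \<sigma> assume s: "\<sigma> \<in> spins N"
  then have "dim_vec \<sigma> = N" and pm: "\<forall>i<N. \<sigma> $ i \<in> {-1, 1}"
    unfolding spins_def by (blast dest: carrier_vecD)+
  then have "\<sigma> = vec N (restrict (\<lambda>i. \<sigma> $ i) {..<N})"
    by (intro eq_vecI) simp_all
  moreover have "restrict (\<lambda>i. \<sigma> $ i) {..<N} \<in> {..<N} \<rightarrow>\<^sub>E {-1, 1}"
    using pm unfolding restrict_PiE_iff by blast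
  ultimately show "\<sigma> \<in> (\<lambda>f. vec N f) ` ({..<N} \<rightarrow>\<^sub>E {-1, 1})"
    by (rule image_eqI)
next
  fix \<sigma> assume "\<sigma> \<in> (\<lambda>f. vec N f) ` ({..<N} \<rightarrow>\<^sub>E {-1, 1 :: real})"
  then obtain f where f: "\<sigma> = vec N f" "f \<in> {..<N} \<rightarrow>\<^sub>E {-1, 1}"
    by blast
  have "vec N f $ i \<in> {-1, 1}" if "i < N" for i
    using PiE_mem[OF f(2), of i] that by (simp only: index_vec lessThan_iff)
  then show "\<sigma> \<in> spins N"
    unfolding spins_def f(1) using vec_carrier by blast
qed

lemma finite_spins: "finite (spins N)"
  unfolding spins_eq_image by (intro finite_imageI finite_PiE) auto

lemma card_spins: "card (spins N) = 2 ^ N"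
proof -
  have "inj_on (\<lambda>f. vec N f) ({..<N} \<rightarrow>\<^sub>E {-1, 1 :: real})"
  proof (rule inj_onI)
    fix f g assume fg: "f \<in> {..<N} \<rightarrow>\<^sub>E {-1, 1 :: real}" "g \<in> {..<N} \<rightarrow>\<^sub>E {-1, 1 :: real}"
      and eq: "vec N f = vec N g"
    have "f i = g i" if "i < N" for i
      using arg_cong[OF eq, of "\<lambda>v. v $ i"] that by simp
    then show "f = g" using fg by (intro PiE_ext[of f _ _ g]) auto
  qed
  then have "card (spins N) = card ({..<N} \<rightarrow>\<^sub>E {-1, 1 :: real})"
    unfolding spins_eq_image by (rule card_image)
  also have "\<dots> = card {-1, 1 :: real} ^ N"
    by (simp add: card_PiE del: card_insert_disjoint)
  also have "card {-1, 1 :: real} = 2"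
    by simp
  finally show ?thesis .
qed

lemma space_orthogonal_borel [simp]: "space (orthogonal_borel N) = orthogonal_group N"
  by (simp add: orthogonal_borel_def)

lemma mult_orthogonal_group:
  assumes "U \<in> orthogonal_group N" "A \<in> orthogonal_group N"
  shows "U * A \<in> orthogonal_group N"
proof -
  have c: "U \<in> carrier_mat N N" "A \<in> carrier_mat N N" "U\<^sup>T \<in> carrier_mat N N" "A\<^sup>T \<in> carrier_mat N N"
    using assms by (auto simp: orthogonal_group_def)
  have o: "A * A\<^sup>T = 1\<^sub>m N" "U * U\<^sup>T = 1\<^sub>m N" "A\<^sup>T * A = 1\<^sub>m N" "U\<^sup>T * U = 1\<^sub>m N"
    using assms by (auto simp: orthogonal_group_def)
  have "U * A * (A\<^sup>T * U\<^sup>T) = U * ((A * A\<^sup>T) * U\<^sup>T)"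
    using c by (simp add: assoc_mult_mat[of _ N N _ N _ N])
  also have "\<dots> = 1\<^sub>m N"
    unfolding o left_mult_one_mat[OF c(3)] ..
  finally have "U * A * (A\<^sup>T * U\<^sup>T) = 1\<^sub>m N" .
  moreover have "A\<^sup>T * U\<^sup>T * (U * A) = 1\<^sub>m N"
  proof -
    have "A\<^sup>T * U\<^sup>T * (U * A) = A\<^sup>T * ((U\<^sup>T * U) * A)"
      using c by (simp add: assoc_mult_mat[of _ N N _ N _ N])
    also have "\<dots> = 1\<^sub>m N"
      unfolding o left_mult_one_mat[OF c(2)] ..
    finally show ?thesis .
  qed
  ultimately show ?thesis
    using c by (simp add: orthogonal_group_def transpose_mult[of U N N A N])
qed

lemma measurable_orthogonal_borel_entry:
  assumes "i < N" "j < N"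
  shows "(\<lambda>A. A $$ (i, j)) \<in> borel_measurable (orthogonal_borel N)"
proof -
  have "(\<lambda>A. \<lambda>p\<in>{..<N} \<times> {..<N}. A $$ p)
      \<in> measurable (orthogonal_borel N) (\<Pi>\<^sub>M p\<in>{..<N} \<times> {..<N}. (borel :: real measure))"
    unfolding orthogonal_borel_def by (intro measurable_vimage_algebra1) (auto simp: space_PiM)
  from measurable_compose[OF this measurable_component_singleton[of "(i, j)"]] assms
  show ?thesis by simp
qed

text \<open>Left translations are Borel, so the \<open>distr\<close> in \<open>haar_orthogonal\<close> is a genuine push-forward.\<close>
lemma measurable_left_mult:
  assumes "U \<in> orthogonal_group N"
  shows "(\<lambda>A. U * A) \<in> measurable (orthogonal_borel N) (orthogonal_borel N)"
proof -
  have U: "U \<in> carrier_mat N N" using assms by (simp add: orthogonal_group_def)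
  have "(\<lambda>A. (U * A) $$ p) \<in> borel_measurable (orthogonal_borel N)" if "p \<in> {..<N} \<times> {..<N}" for p
  proof -
    have "(\<lambda>A. \<Sum>k<N. U $$ (fst p, k) * A $$ (k, snd p)) \<in> borel_measurable (orthogonal_borel N)"
      using that
      by (intro borel_measurable_sum borel_measurable_times borel_measurable_const
          measurable_orthogonal_borel_entry) auto
    then show ?thesis
      using that U
      by (subst measurable_cong[where g = "\<lambda>A. \<Sum>k<N. U $$ (fst p, k) * A $$ (k, snd p)"])
         (auto simp: orthogonal_group_def scalar_prod_def atLeast0LessThan intro!: sum.cong)
  qed
  then have "(\<lambda>A. \<lambda>p\<in>{..<N} \<times> {..<N}. (U * A) $$ p)
      \<in> measurable (orthogonal_borel N) (\<Pi>\<^sub>M p\<in>{..<N} \<times> {..<N}. borel)"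
    by (intro measurable_restrict)
  then show ?thesis
    unfolding orthogonal_borel_def[of N]
    by (intro measurable_vimage_algebra2)
       (auto simp: orthogonal_borel_def[symmetric] mult_orthogonal_group[OF assms])
qed

end

theory Submission
  imports Defs "HOL-Real_Asymp.Real_Asymp"
begin

text \<open>
  Write \<open>x(\<sigma>) = \<sigma>\<^sup>T O D O\<^sup>T \<sigma> / N\<close> and let \<open>F\<close> be the limit, so that \<open>q = F'\<close> solves
  \<open>q = 2\<beta>(1 - q\<^sup>2)\<close>. Invariance of the Haar measure under rotations of two rows of \<open>O\<close> gives
  integration-by-parts identities. Under the annealed measure they force the mean of
  \<open>x - 2\<beta>(1 - x\<^sup>2)\<close> to be the mean of the \<open>d\<^sub>i\<close>, hence \<open>E exp(\<beta>N x) \<le> exp(N F(\<beta>) + o(N))\<close>; for two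
  replicas with overlap \<open>r\<close> they give \<open>E exp(\<beta>N(x + x')) \<le> exp(2N F(\<beta>) + 2\<beta>\<^sup>2N r\<^sup>2 + o(N))\<close>.
  Under the quenched Gibbs measure they express \<open>\<langle>x\<rangle> - q\<close> through \<open>\<langle>(x - q)\<^sup>2\<rangle>\<close> and \<open>\<langle>r\<^sup>2\<rangle>\<close>, which by
  Jensen's inequality and the annealed bounds are at most a constant times the gap \<open>F - p\<close>,
  where \<open>p\<close> is the mean free energy. As \<open>p'\<close> is the mean of \<open>\<langle>x\<rangle>\<close>, Gronwall's inequality closes the
  argument (Guerra's quadratic coupling method). No concentration of measure is needed: an upper
  bound on \<open>E Z\<close> and a matching lower bound on \<open>E log Z\<close> already give convergence in \<open>L\<^sup>1\<close>.
\<close>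

section \<open>Elementary inequalities and the limiting free energy\<close>

text \<open>What closes the system of identities is that \<open>d\<close> takes the values 1 and -1:
  J = O D O^T then satisfies J^2 = 1, so J sigma is as long as sigma, and integration by parts
  produces only energies, overlaps and the cross energy sigma^T J tau / N. The smallness of beta has
  a single source. The average of exp (c N r^2) over a uniform replica is polynomial in N only for c
  up to 1/2. The weight N/4 used to control r^2 meets the coupling term 2 beta^2 N r^2, so 1/4 + 2
  beta^2 must not exceed 1/2, that is, beta^2 must not exceed 1/8; the value 1/3 is a convenient
  choice of this kind.\<close>

lemma cosh_le_exp_half_square:
  fixes x :: real
  shows "cosh x \<le> exp (x\<^sup>2 / 2)"
proof -
  \<comment> \<open>Equivalently, the logarithmic derivative tanh t of cosh is at most t, the
    logarithmic derivative of exp (t^2 / 2).\<close>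
  have sinh_le: "sinh t \<le> t * cosh t" if "0 \<le> t" for t :: real
  proof -
    have "(\<lambda>t::real. t * cosh t - sinh t) 0 \<le> (\<lambda>t. t * cosh t - sinh t) t"
    proof (rule DERIV_nonneg_imp_nondecreasing[OF that])
      fix s :: real assume "0 \<le> s" "s \<le> t"
      then have "((\<lambda>t. t * cosh t - sinh t) has_real_derivative s * sinh s) (at s)" "0 \<le> s * sinh s"
        by (auto intro!: derivative_eq_intros)
      then show "\<exists>y. ((\<lambda>t. t * cosh t - sinh t) has_real_derivative y) (at s) \<and> 0 \<le> y"
        by blast
    qed
    then show ?thesis by simp
  qed
  have "cosh t \<le> exp (t\<^sup>2 / 2)" if "0 \<le> t" for t :: real
  proof -
    have "(\<lambda>t::real. - cosh t * exp (- (t\<^sup>2 / 2))) 0 \<le> (\<lambda>t. - cosh t * exp (- (t\<^sup>2 / 2))) t"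
    proof (rule DERIV_nonneg_imp_nondecreasing[OF that])
      fix s :: real assume s: "0 \<le> s" "s \<le> t"
      have "((\<lambda>t. - cosh t * exp (- (t\<^sup>2 / 2))) has_real_derivative
              (s * cosh s - sinh s) * exp (- (s\<^sup>2 / 2))) (at s)"
        by (auto intro!: derivative_eq_intros simp: algebra_simps)
      moreover have "0 \<le> (s * cosh s - sinh s) * exp (- (s\<^sup>2 / 2))"
        using sinh_le[OF s(1)] by simp
      ultimately show "\<exists>y. ((\<lambda>t. - cosh t * exp (- (t\<^sup>2 / 2))) has_real_derivative y) (at s) \<and> 0 \<le> y"
        by blast
    qed
    then show ?thesis by (simp add: exp_minus field_simps)
  qed
  from this[of "\<bar>x\<bar>"] show ?thesis by simp
qed

text \<open>A discrete substitute for Gaussian linearisation of the square.\<close>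
lemma exp_square_le_sum_exp:
  fixes c y :: real
  assumes c: "0 \<le> c" and y: "\<bar>y\<bar> \<le> 2" and N: "0 < N"
  shows "exp (c * real N * y\<^sup>2) \<le>
    exp c * (\<Sum>k\<in>{- 2 * int N .. 2 * int N}. exp (2 * c * k * y - c * (real_of_int k)\<^sup>2 / N))"
proof -
  \<comment> \<open>Over real k the exponent 2 c k y - c k^2 / N is maximal at k = N y, with value c
    N y^2. Rounding to an integer loses at most c / N, which the factor \<open>exp c\<close>
    absorbs. The range of k has 4 N + 1 elements; this is the source of every later factor 4 N +
    1.\<close>
  define k where "k = \<lfloor>real N * y\<rfloor>"
  have Ny: "\<bar>real N * y\<bar> \<le> 2 * real N"
    using y N by (simp add: abs_mult)
  then have k: "k \<in> {- 2 * int N .. 2 * int N}"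
    unfolding k_def by (simp add: abs_le_iff; linarith)
  have "\<bar>real N * y - k\<bar> \<le> 1"
    unfolding k_def by linarith
  then have "(real N * y - k)\<^sup>2 \<le> 1"
    by (simp add: abs_square_le_1)
  then have "c / N * (real N * y - k)\<^sup>2 \<le> c / N * 1"
    using c by (intro mult_left_mono) auto
  also have "\<dots> \<le> c"
    using mult_left_mono[of 1 "real N" c] c N by (simp add: divide_le_eq)
  finally have "c * real N * y\<^sup>2 \<le> c + (2 * c * k * y - c * (real_of_int k)\<^sup>2 / N)"
    using N by (simp add: field_simps power2_eq_square)
  then have "exp (c * real N * y\<^sup>2) \<le> exp c * exp (2 * c * k * y - c * (real_of_int k)\<^sup>2 / N)"
    by (simp flip: exp_add)
  also have "\<dots> \<le> exp c * (\<Sum>k\<in>{- 2 * int N .. 2 * int N}. exp (2 * c * k * y - c * (real_of_int k)\<^sup>2 / N))"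
    using k by (intro mult_left_mono member_le_sum) auto
  finally show ?thesis .
qed

text \<open>Jensen's inequality for the Gibbs weights of \<open>u\<close>. It turns the mean of an
  observable into the logarithm of an exponential moment.\<close>

lemma gibbs_mean_le_ln:
  fixes u a :: "'i \<Rightarrow> real"
  assumes J: "finite J" "J \<noteq> {}"
  shows "(\<Sum>j\<in>J. exp (u j) / (\<Sum>i\<in>J. exp (u i)) * a j)
    \<le> ln (\<Sum>j\<in>J. exp (u j + a j)) - ln (\<Sum>j\<in>J. exp (u j))"
proof -
  define Z where "Z = (\<Sum>j\<in>J. exp (u j))"
  define W where "W = (\<Sum>j\<in>J. exp (u j + a j))"
  have Z: "Z > 0" and W: "W > 0"
    unfolding Z_def W_def using J by (auto intro: sum_pos)
  \<comment> \<open>This shift makes the Gibbs mean of exp (a - b) equal to 1, so averaging exp (a -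
    b) >= 1 + a - b leaves exactly b.\<close>
  define b where "b = ln W - ln Z"
  have "(\<Sum>j\<in>J. exp (u j) / Z * a j) \<le> (\<Sum>j\<in>J. exp (u j) / Z * (exp (a j - b) - 1 + b))"
    using Z exp_ge_add_one_self[of "a _ - b"] by (intro sum_mono mult_left_mono) (auto simp: algebra_simps)
  also have "\<dots> = (\<Sum>j\<in>J. exp (u j + a j) * exp (- b) / Z + exp (u j) / Z * (b - 1))"
    by (intro sum.cong refl)
      (simp add: diff_conv_add_uminus exp_add distrib_left add_divide_distrib del: add_uminus_conv_diff)
  also have "\<dots> = W * exp (- b) / Z + Z / Z * (b - 1)"
    by (simp add: sum.distrib W_def Z_def flip: sum_divide_distrib sum_distrib_right)
  also have "exp (- b) = Z / W"
    unfolding b_def using Z W by (simp add: exp_diff)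
  also have "W * (Z / W) / Z + Z / Z * (b - 1) = b"
    using Z W by simp
  finally show ?thesis unfolding b_def Z_def W_def .
qed

text \<open>The derivative of \<open>f t * exp (- A * t)\<close> is at most
  \<open>e * exp (- A * t)\<close>. Bounding this further by \<open>e\<close> avoids a division by
  \<open>A\<close>, so the case \<open>A = 0\<close> is included.\<close>

lemma gronwall_affine:
  fixes f :: "real \<Rightarrow> real"
  assumes f: "\<And>t. 0 \<le> t \<Longrightarrow> t \<le> b \<Longrightarrow> (f has_real_derivative f' t) (at t)"
    and le: "\<And>t. 0 \<le> t \<Longrightarrow> t \<le> b \<Longrightarrow> f' t \<le> A * f t + e"
    and "f 0 = 0" "0 \<le> A" "0 \<le> e" "0 \<le> b"
  shows "f b \<le> e * b * exp (A * b)"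
proof -
  have "(\<lambda>t. e * t - f t * exp (- A * t)) 0 \<le> (\<lambda>t. e * t - f t * exp (- A * t)) b"
  proof (rule DERIV_nonneg_imp_nondecreasing[OF \<open>0 \<le> b\<close>])
    fix t assume t: "0 \<le> t" "t \<le> b"
    have "((\<lambda>t. e * t - f t * exp (- A * t)) has_real_derivative e - (f' t - A * f t) * exp (- A * t)) (at t)"
      by (auto intro!: derivative_eq_intros f[OF t] simp: algebra_simps)
    moreover have "(f' t - A * f t) * exp (- A * t) \<le> e * exp (- A * t)"
      using le[OF t] by (intro mult_right_mono) auto
    moreover have "e * exp (- A * t) \<le> e * 1"
      using t \<open>0 \<le> A\<close> \<open>0 \<le> e\<close> by (intro mult_left_mono) auto
    ultimately show "\<exists>y. ((\<lambda>t. e * t - f t * exp (- A * t)) has_real_derivative y) (at t) \<and> 0 \<le> y"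
      by (intro exI[of _ "e - (f' t - A * f t) * exp (- A * t)"] conjI) (assumption, linarith)
  qed
  then have "f b * exp (- A * b) \<le> e * b" using assms(3) by simp
  then show ?thesis by (simp add: exp_minus field_simps)
qed

section \<open>The limiting free energy and its slope\<close>

definition rom_slope :: "real \<Rightarrow> real" where
  "rom_slope t = 4 * t / (1 + sqrt (16 * t\<^sup>2 + 1))"

text \<open>Both formulas are rationalised so that they are also correct and differentiable at t =
  0, where the quotient in the theorem divides by zero: the differential inequalities start at 0 and
  the tilts may change sign. The slope is the root of 2 t q^2 + q - 2 t that vanishes at t =
  0.\<close>

definition rom_energy :: "real \<Rightarrow> real" where
  "rom_energy t = 1 / 4 * (sqrt (16 * t\<^sup>2 + 1) + ln (2 / (1 + sqrt (16 * t\<^sup>2 + 1))) - 1)"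

lemma sqrt_rom_ge_1: "1 \<le> sqrt (16 * t\<^sup>2 + 1)" for t :: real
  by simp

lemma rom_denominator_pos: "0 < 16 * t\<^sup>2 + 1" "1 + sqrt (16 * t\<^sup>2 + 1) \<noteq> 0" for t :: real
proof -
  show "0 < 16 * t\<^sup>2 + 1" by (simp add: add_nonneg_pos)
  show "1 + sqrt (16 * t\<^sup>2 + 1) \<noteq> 0" using sqrt_rom_ge_1[of t] by linarith
qed

lemma DERIV_sqrt_rom:
  "((\<lambda>t. sqrt (16 * t\<^sup>2 + 1)) has_real_derivative 16 * t / sqrt (16 * t\<^sup>2 + 1)) (at t)" for t :: real
proof -
  have "0 < 16 * t\<^sup>2 + 1" by (simp add: add_nonneg_pos)
  then show ?thesis
    by (auto intro!: derivative_eq_intros simp: field_simps)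
qed

lemma rom_energy_eq:
  assumes "t \<noteq> 0"
  shows "rom_energy t = 1 / 4 * (sqrt (16 * t^2 + 1) + ln ((sqrt (16 * t^2 + 1) - 1) / (8 * t^2)) - 1)"
proof -
  define S where "S = sqrt (16 * t\<^sup>2 + 1)"
  have S2: "S\<^sup>2 = 16 * t\<^sup>2 + 1" and S: "1 \<le> S" unfolding S_def by (auto simp: add_nonneg_nonneg)
  have "(S - 1) / (8 * t\<^sup>2) = 2 / (1 + S)"
    using assms S S2 by (simp add: field_simps power2_eq_square)
  then show ?thesis unfolding rom_energy_def S_def[symmetric] by simp
qed

lemma rom_slope_fixed_point: "rom_slope t = 2 * t * (1 - (rom_slope t)\<^sup>2)"
proof -
  define S where "S = sqrt (16 * t\<^sup>2 + 1)"
  have S2: "S * S = 16 * t * t + 1" and S: "1 + S \<noteq> 0"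
    using rom_denominator_pos[of t] unfolding S_def
    by (auto simp: power2_eq_square)
  have "(4 * t / (1 + S))\<^sup>2 = (S - 1) / (1 + S)"
    using S S2 by (simp add: power2_eq_square divide_simps) (simp add: algebra_simps)
  then have "1 - (4 * t / (1 + S))\<^sup>2 = 2 / (1 + S)"
    using S by (simp add: field_simps)
  then show ?thesis
    unfolding rom_slope_def S_def[symmetric] by simp
qed

lemma rom_slope_sign: "0 \<le> t * rom_slope t"
proof -
  have "t * rom_slope t = 4 * t\<^sup>2 / (1 + sqrt (16 * t\<^sup>2 + 1))"
    by (simp add: rom_slope_def power2_eq_square)
  then show ?thesis using sqrt_rom_ge_1[of t] by simp
qed

lemma abs_rom_slope_le_1: "\<bar>rom_slope t\<bar> \<le> 1"
proof -
  have "\<bar>4 * t\<bar> = sqrt (16 * t\<^sup>2)"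
    by (simp add: real_sqrt_mult)
  also have "\<dots> \<le> sqrt (16 * t\<^sup>2 + 1)" by (rule real_sqrt_le_mono) simp
  finally show ?thesis
    unfolding rom_slope_def using sqrt_rom_ge_1[of t] by (simp add: abs_divide abs_mult)
qed

lemma rom_energy_0 [simp]: "rom_energy 0 = 0"
  by (simp add: rom_energy_def)

lemma rom_energy_minus [simp]: "rom_energy (- t) = rom_energy t"
  by (simp add: rom_energy_def)

lemma DERIV_rom_energy: "(rom_energy has_real_derivative rom_slope t) (at t)"
proof -
  define S where "S = sqrt (16 * t\<^sup>2 + 1)"
  have S: "1 \<le> S" unfolding S_def by simp
  define f where "f = (\<lambda>t::real. sqrt (16 * t\<^sup>2 + 1))"
  have f: "(f has_real_derivative 16 * t / S) (at t)" "f t = S"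
    unfolding f_def S_def by (rule DERIV_sqrt_rom, rule refl)
  have "((\<lambda>t. 1 / 4 * (f t + (ln 2 - ln (1 + f t)) - 1))
     has_real_derivative 1 / 4 * (16 * t / S - 16 * t / S / (1 + S))) (at t)"
    using S f(2) by (auto intro!: derivative_eq_intros f(1))
  moreover have "1 / 4 * (16 * t / S - 16 * t / S / (1 + S)) = rom_slope t"
    unfolding rom_slope_def S_def[symmetric] using S by (simp add: divide_simps) (simp add: algebra_simps)
  moreover have "rom_energy = (\<lambda>t. 1 / 4 * (f t + (ln 2 - ln (1 + f t)) - 1))"
    unfolding rom_energy_def f_def using rom_denominator_pos(2) by (intro ext) (simp add: ln_div)
  ultimately show ?thesis by simp
qed

text \<open>With S = sqrt (16 x^2 + 1) the derivative is 4 / (S (1 + S)), at most 2 because S >= 1,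
  with equality at x = 0.\<close>

lemma rom_slope_lipschitz:
  assumes "s \<le> t"
  shows "rom_slope t - rom_slope s \<le> 2 * (t - s)"
proof -
  have "(\<lambda>t. 2 * t - rom_slope t) s \<le> (\<lambda>t. 2 * t - rom_slope t) t"
  proof (rule DERIV_nonneg_imp_nondecreasing[OF assms])
    fix x :: real
    define S where "S = sqrt (16 * x\<^sup>2 + 1)"
    have S: "1 \<le> S" "S * S = 16 * x * x + 1" unfolding S_def by (auto simp: add_nonneg_nonneg power2_eq_square)
    define f where "f = (\<lambda>t::real. sqrt (16 * t\<^sup>2 + 1))"
    have f: "(f has_real_derivative 16 * x / S) (at x)" "f x = S"
      unfolding f_def S_def by (rule DERIV_sqrt_rom, rule refl)
    have "((\<lambda>t. 2 * t - 4 * t / (1 + f t)) has_real_derivative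
        2 - (4 * (1 + S) - 4 * x * (16 * x / S)) / ((1 + S) * (1 + S))) (at x)"
      using S(1) f(2) by (auto intro!: derivative_eq_intros f(1))
    moreover have "(4 * (1 + S) - 4 * x * (16 * x / S)) / ((1 + S) * (1 + S)) = 4 / (S * (1 + S))"
    proof -
      have "4 * x * (16 * x / S) = 4 * (S * S - 1) / S" using S by simp
      also have "4 * (1 + S) - \<dots> = 4 * (1 + S) / S" using S(1) by (simp add: field_simps)
      finally have "4 * (1 + S) - 4 * x * (16 * x / S) = 4 * (1 + S) / S" .
      then show ?thesis using S(1) by (simp add: divide_simps)
    qed
    moreover have "4 / (S * (1 + S)) \<le> 2"
    proof -
      have "1 * 2 \<le> S * (1 + S)" using S(1) by (intro mult_mono) auto
      then show ?thesis by (simp add: divide_le_eq)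
    qed
    ultimately show "\<exists>y. ((\<lambda>t. 2 * t - rom_slope t) has_real_derivative y) (at x) \<and> 0 \<le> y"
      unfolding rom_slope_def f_def by (intro exI conjI) (assumption, simp)
  qed
  then show ?thesis by simp
qed

text \<open>The second derivative of \<open>rom_energy\<close> is at most 2. This decides the
  coefficient 1/4 in \<open>annealed_square_bound\<close>, because the maximum of h y - h^2 over h
  is y^2 / 4.\<close>

lemma rom_energy_le_quadratic: "rom_energy (b + h) \<le> rom_energy b + h * rom_slope b + h\<^sup>2"
proof -
  let ?g = "\<lambda>t. rom_energy b + (t - b) * rom_slope b + (t - b)\<^sup>2 - rom_energy t"
  have d: "(?g has_real_derivative rom_slope b + 2 * (t - b) - rom_slope t) (at t)" for t
    by (auto intro!: derivative_eq_intros DERIV_rom_energy)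
  have "0 \<le> ?g (b + h)"
  proof (cases "0 \<le> h")
    case True
    have "?g b \<le> ?g (b + h)"
    proof (rule DERIV_nonneg_imp_nondecreasing[where f = ?g])
      show "b \<le> b + h" using True by simp
      fix t assume "b \<le> t"
      then show "\<exists>y. (?g has_real_derivative y) (at t) \<and> 0 \<le> y"
        using d[of t] rom_slope_lipschitz[of b t]
        by (intro exI[of _ "rom_slope b + 2 * (t - b) - rom_slope t"]) auto
    qed
    then show ?thesis by simp
  next
    case False
    have "?g b \<le> ?g (b + h)"
    proof (rule DERIV_nonpos_imp_nonincreasing[where f = ?g])
      show "b + h \<le> b" using False by simp
      fix t assume "t \<le> b"
      then show "\<exists>y. (?g has_real_derivative y) (at t) \<and> y \<le> 0"
        using d[of t] rom_slope_lipschitz[of t b] by (intro exI[of _ "rom_slope b + 2 * (t - b) - rom_slope t"]) auto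
    qed
    then show ?thesis by simp
  qed
  then show ?thesis by simp
qed

text \<open>Dominated convergence for the difference quotients: the mean value inequality turns the
  local bound \<open>C\<close> on the derivative into a dominating constant. Arguing along sequences
  matches the form of the convergence theorem.\<close>

lemma (in prob_space) DERIV_expectation:
  fixes h h' :: "real \<Rightarrow> 'a \<Rightarrow> real"
  assumes e: "0 < e"
    and D: "\<And>s \<omega>. \<bar>s - t\<bar> < e \<Longrightarrow> \<omega> \<in> space M \<Longrightarrow> ((\<lambda>s. h s \<omega>) has_real_derivative h' s \<omega>) (at s)"
    and C: "\<And>s \<omega>. \<bar>s - t\<bar> < e \<Longrightarrow> \<omega> \<in> space M \<Longrightarrow> \<bar>h' s \<omega>\<bar> \<le> C"
    and int: "\<And>s. integrable M (h s)"
    and meas: "h' t \<in> borel_measurable M"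
  shows "((\<lambda>s. expectation (h s)) has_real_derivative expectation (h' t)) (at t)"
proof -
  have C0: "0 \<le> C"
    using C[of t] e not_empty by fastforce
  have "((\<lambda>n. (expectation (h (X n)) - expectation (h t)) / (X n - t)) \<longlongrightarrow> expectation (h' t)) sequentially"
    if X: "\<And>n. X n \<noteq> t" "X \<longlonglongrightarrow> t" for X
  proof -
    obtain n0 where n0: "\<And>n. n \<ge> n0 \<Longrightarrow> \<bar>X n - t\<bar> < e"
      using X(2) e unfolding lim_sequentially dist_real_def by blast
    let ?Y = "\<lambda>n. X (n + n0)"
    have Y: "?Y \<longlonglongrightarrow> t" "\<And>n. ?Y n \<noteq> t" using X by (auto intro: LIMSEQ_ignore_initial_segment)
    have "(\<lambda>n. expectation (\<lambda>\<omega>. (h (?Y n) \<omega> - h t \<omega>) / (?Y n - t))) \<longlonglongrightarrow> expectation (h' t)"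
    proof (rule integral_dominated_convergence[where w = "\<lambda>_. C"])
      show "AE \<omega> in M. (\<lambda>n. (h (?Y n) \<omega> - h t \<omega>) / (?Y n - t)) \<longlonglongrightarrow> h' t \<omega>"
      proof (rule AE_I2)
        fix \<omega> assume "\<omega> \<in> space M"
        then have "((\<lambda>s. (h s \<omega> - h t \<omega>) / (s - t)) \<longlongrightarrow> h' t \<omega>) (at t)"
          using D[of t \<omega>] e by (simp add: has_field_derivative_iff)
        then show "(\<lambda>n. (h (?Y n) \<omega> - h t \<omega>) / (?Y n - t)) \<longlonglongrightarrow> h' t \<omega>"
          using Y unfolding tendsto_at_iff_sequentially comp_def by (elim allE[of _ ?Y]) simp
      qed
      show "AE \<omega> in M. norm ((h (?Y n) \<omega> - h t \<omega>) / (?Y n - t)) \<le> C" for n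
      proof (rule AE_I2)
        fix \<omega> assume w: "\<omega> \<in> space M"
        have "norm (h (?Y n) \<omega> - h t \<omega>) \<le> C * norm (?Y n - t)"
        proof (rule field_differentiable_bound[where S = "ball t e"])
          show "((\<lambda>s. h s \<omega>) has_field_derivative h' s \<omega>) (at s within ball t e)" if "s \<in> ball t e" for s
            using D[of s \<omega>] that w by (auto simp: dist_real_def abs_minus_commute intro: DERIV_subset)
          show "norm (h' s \<omega>) \<le> C" if "s \<in> ball t e" for s
            using C[of s \<omega>] that w by (auto simp: dist_real_def abs_minus_commute)
        qed (use n0[of "n + n0"] e in \<open>auto simp: dist_real_def abs_minus_commute\<close>)
        then show "norm ((h (?Y n) \<omega> - h t \<omega>) / (?Y n - t)) \<le> C"
          using Y(2)[of n] by (simp add: divide_le_eq)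
      qed
      have [measurable]: "h s \<in> borel_measurable M" for s using int[of s] by simp
      show "(\<lambda>\<omega>. (h (?Y n) \<omega> - h t \<omega>) / (?Y n - t)) \<in> borel_measurable M" for n
        by measurable
    qed (use meas in auto)
    then have "(\<lambda>n. (expectation (h (?Y n)) - expectation (h t)) / (?Y n - t)) \<longlonglongrightarrow> expectation (h' t)"
      using int by simp
    then show ?thesis by (rule LIMSEQ_offset)
  qed
  then show ?thesis
    unfolding has_field_derivative_iff tendsto_at_iff_sequentially comp_def by auto
qed

section \<open>Rotations of two rows\<close>

definition rotate_rows :: "nat \<Rightarrow> nat \<Rightarrow> nat \<Rightarrow> real \<Rightarrow> real mat \<Rightarrow> real mat" where
  "rotate_rows N a b s A = mat N N (\<lambda>(i, j).
     if i = a then cos s * A $$ (a, j) + sin s * A $$ (b, j)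
     else if i = b then cos s * A $$ (b, j) - sin s * A $$ (a, j)
     else A $$ (i, j))"

lemma orthogonal_groupD:
  assumes "A \<in> orthogonal_group N"
  shows orthogonal_carrier: "A \<in> carrier_mat N N"
    and orthogonal_rows: "\<And>i j. i < N \<Longrightarrow> j < N \<Longrightarrow> (\<Sum>k<N. A $$ (i, k) * A $$ (j, k)) = of_bool (i = j)"
    and orthogonal_cols: "\<And>i j. i < N \<Longrightarrow> j < N \<Longrightarrow> (\<Sum>k<N. A $$ (k, i) * A $$ (k, j)) = of_bool (i = j)"
proof -
  show A: "A \<in> carrier_mat N N" using assms by (simp add: orthogonal_group_def)
  fix i j assume ij: "i < N" "j < N"
  have "(A * A\<^sup>T) $$ (i, j) = (\<Sum>k<N. A $$ (i, k) * A $$ (j, k))"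
    using A ij by (simp add: scalar_prod_def atLeast0LessThan)
  then show "(\<Sum>k<N. A $$ (i, k) * A $$ (j, k)) = of_bool (i = j)"
    using assms ij by (auto simp: orthogonal_group_def)
  have "(A\<^sup>T * A) $$ (i, j) = (\<Sum>k<N. A $$ (k, i) * A $$ (k, j))"
    using A ij by (simp add: scalar_prod_def atLeast0LessThan)
  then show "(\<Sum>k<N. A $$ (k, i) * A $$ (k, j)) = of_bool (i = j)"
    using assms ij by (auto simp: orthogonal_group_def)
qed

context
  fixes N a b :: nat
  assumes ab: "a < N" "b < N" "a \<noteq> b"
begin

text \<open>The rotation matrix applied to a vector \<open>f\<close>. Both the orthogonality of this
  matrix and the product formula \<open>rotate_rows_eq_mult\<close> reduce to it.\<close>

lemma rotate_rows_one_sum: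
  assumes "i < N"
  shows "(\<Sum>k<N. rotate_rows N a b s (1\<^sub>m N) $$ (i, k) * f k) =
    (if i = a then cos s * f a + sin s * f b
     else if i = b then cos s * f b - sin s * f a else f i)"
proof -
  have "(\<Sum>k<N. (if k = a then u * f k else 0) + (if k = b then v * f k else 0)) = u * f a + v * f b" for u v
    using ab by (simp add: sum.distrib)
  note two = this
  consider "i = a" | "i = b" | "i \<noteq> a" "i \<noteq> b" by blast
  then show ?thesis
  proof cases
    case 1
    then show ?thesis
      using ab assms two[of "cos s" "sin s", symmetric]
      by (auto simp: rotate_rows_def intro!: sum.cong)
  next
    case 2
    then show ?thesis
      using ab assms two[of "- sin s" "cos s", symmetric]
      by (auto simp: rotate_rows_def intro!: sum.cong)
  next
    case 3
    have "(\<Sum>k<N. rotate_rows N a b s (1\<^sub>m N) $$ (i, k) * f k) = (\<Sum>k<N. if k = i then f k else 0)"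
      by (intro sum.cong refl) (use 3 ab assms in \<open>auto simp: rotate_rows_def\<close>)
    then show ?thesis using 3 assms by simp
  qed
qed

lemma rotate_rows_one_orthogonal: "rotate_rows N a b s (1\<^sub>m N) \<in> orthogonal_group N"
proof -
  let ?G = "\<lambda>s. rotate_rows N a b s (1\<^sub>m N)"
  have c: "?G s \<in> carrier_mat N N" for s by (simp add: rotate_rows_def)
  have row: "?G s * (?G s)\<^sup>T = 1\<^sub>m N" for s
  proof (intro eq_matI)
    fix i j assume ij: "i < dim_row (1\<^sub>m N)" "j < dim_col (1\<^sub>m N)"
    have "(?G s * (?G s)\<^sup>T) $$ (i, j) = (\<Sum>k<N. ?G s $$ (i, k) * ?G s $$ (j, k))"
      using c[of s] ij by (simp add: scalar_prod_def atLeast0LessThan)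
    also have "\<dots> = 1\<^sub>m N $$ (i, j)"
      using ij ab sin_cos_squared_add[of s]
      by (subst rotate_rows_one_sum) (auto simp: rotate_rows_def power2_eq_square add.commute)
    finally show "(?G s * (?G s)\<^sup>T) $$ (i, j) = 1\<^sub>m N $$ (i, j)" .
  qed (simp_all add: rotate_rows_def)
  \<comment> \<open>Transposing reverses the angle, so the second orthogonality relation is the
    first one at angle -s.\<close>
  have tr: "(?G s)\<^sup>T = ?G (- s)" for s
    using ab by (intro eq_matI) (auto simp: rotate_rows_def)
  have "(?G s)\<^sup>T * ?G s = 1\<^sub>m N" for s
    using row[of "- s"] unfolding tr by simp
  then show ?thesis using c row by (simp add: orthogonal_group_def)
qed

text \<open>The entrywise form is the one to differentiate; the product form is the one to which
  left invariance of the Haar measure applies.\<close>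

lemma rotate_rows_eq_mult:
  assumes "A \<in> carrier_mat N N"
  shows "rotate_rows N a b s A = rotate_rows N a b s (1\<^sub>m N) * A"
proof (intro eq_matI)
  let ?G = "rotate_rows N a b s (1\<^sub>m N)"
  have c: "?G \<in> carrier_mat N N" by (simp add: rotate_rows_def)
  fix i j assume "i < dim_row (?G * A)" "j < dim_col (?G * A)"
  with c assms have ij: "i < N" "j < N" by auto
  have "(?G * A) $$ (i, j) = (\<Sum>k<N. ?G $$ (i, k) * A $$ (k, j))"
    using c assms ij by (simp add: scalar_prod_def atLeast0LessThan)
  then show "rotate_rows N a b s A $$ (i, j) = (?G * A) $$ (i, j)"
    using ij ab by (subst (asm) rotate_rows_one_sum) (auto simp: rotate_rows_def)
qed (use assms in \<open>simp_all add: rotate_rows_def\<close>)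

lemma rotate_rows_orthogonal:
  "A \<in> orthogonal_group N \<Longrightarrow> rotate_rows N a b s A \<in> orthogonal_group N"
  by (subst rotate_rows_eq_mult) (auto intro: orthogonal_carrier mult_orthogonal_group rotate_rows_one_orthogonal)

lemma rotate_rows_0:
  "A \<in> orthogonal_group N \<Longrightarrow> rotate_rows N a b 0 A = A"
  by (drule orthogonal_carrier, intro eq_matI) (auto simp: rotate_rows_def)

lemma rotate_rows_add:
  "rotate_rows N a b (s + t) A = rotate_rows N a b t (rotate_rows N a b s A)"
proof (intro eq_matI)
  fix i j
  assume "i < dim_row (rotate_rows N a b t (rotate_rows N a b s A))"
    "j < dim_col (rotate_rows N a b t (rotate_rows N a b s A))"
  then have ij: "i < N" "j < N" by (simp_all add: rotate_rows_def)
  consider "i = a" | "i = b" | "i \<noteq> a" "i \<noteq> b" by blast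
  then show "rotate_rows N a b (s + t) A $$ (i, j) = rotate_rows N a b t (rotate_rows N a b s A) $$ (i, j)"
    by cases (use ab ij in \<open>simp_all add: rotate_rows_def cos_add sin_add distrib_left
      distrib_right left_diff_distrib right_diff_distrib\<close>)
qed (simp_all add: rotate_rows_def)

end

section \<open>Integration by parts on the orthogonal group\<close>

locale haar_signs =
  fixes N :: nat and d :: "nat \<Rightarrow> real" and \<mu> :: "real mat measure"
  assumes N_pos: "0 < N"
    and sign: "\<And>i. i < N \<Longrightarrow> d i \<in> {-1, 1}"
    and haar: "haar_orthogonal N \<mu>"

sublocale haar_signs \<subseteq> prob_space \<mu>
  using haar by (simp add: haar_orthogonal_def)

context haar_signs
begin

abbreviation "orth \<equiv> orthogonal_group N"

lemma sets_haar [measurable_cong]: "sets \<mu> = sets (orthogonal_borel N)"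
  using haar by (simp add: haar_orthogonal_def)

lemma space_haar [simp]: "space \<mu> = orth"
  using sets_eq_imp_space_eq[OF sets_haar] by simp

text \<open>A class closed under the algebraic operations used below, which settles integrability
  and domination for all integrands at once.\<close>

definition observable :: "(real mat \<Rightarrow> real) \<Rightarrow> bool" where
  "observable f \<longleftrightarrow> f \<in> borel_measurable \<mu> \<and> (\<exists>C. \<forall>A\<in>orth. \<bar>f A\<bar> \<le> C)"

lemma observable_measurable: "observable f \<Longrightarrow> f \<in> borel_measurable \<mu>"
  by (simp add: observable_def)

lemma observable_integrable: "observable f \<Longrightarrow> integrable \<mu> f"
  unfolding observable_def by (auto intro!: integrable_const_bound AE_I2)

lemma observable_const: "observable (\<lambda>_. c)"
  unfolding observable_def by auto

lemma observable_uminus: "observable f \<Longrightarrow> observable (\<lambda>A. - f A)"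
  unfolding observable_def by auto

lemma observable_add:
  assumes "observable f" "observable g"
  shows "observable (\<lambda>A. f A + g A)"
proof -
  obtain C D where "\<forall>A\<in>orth. \<bar>f A\<bar> \<le> C" "\<forall>A\<in>orth. \<bar>g A\<bar> \<le> D"
    using assms unfolding observable_def by blast
  then have "\<forall>A\<in>orth. \<bar>f A + g A\<bar> \<le> C + D" by (meson abs_triangle_ineq add_mono order_trans)
  then show ?thesis using assms unfolding observable_def by auto
qed

lemma observable_diff: "observable f \<Longrightarrow> observable g \<Longrightarrow> observable (\<lambda>A. f A - g A)"
  using observable_add[of f "\<lambda>A. - g A"] observable_uminus[of g] by simp

lemma observable_mult:
  assumes "observable f" "observable g"
  shows "observable (\<lambda>A. f A * g A)"
proof -
  obtain C D where "\<forall>A\<in>orth. \<bar>f A\<bar> \<le> C" "\<forall>A\<in>orth. \<bar>g A\<bar> \<le> D"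
    using assms unfolding observable_def by blast
  then have "\<forall>A\<in>orth. \<bar>f A * g A\<bar> \<le> C * D"
    by (auto simp: abs_mult intro!: mult_mono intro: order_trans[OF abs_ge_zero])
  then show ?thesis using assms unfolding observable_def by auto
qed

lemma observable_sum:
  "(\<And>i. i \<in> I \<Longrightarrow> observable (f i)) \<Longrightarrow> observable (\<lambda>A. \<Sum>i\<in>I. f i A)"
  by (induction I rule: infinite_finite_induct) (auto intro: observable_const observable_add)

lemma observable_power: "observable f \<Longrightarrow> observable (\<lambda>A. f A ^ n)"
  by (induction n) (auto intro: observable_const observable_mult)

lemma observable_divide_const: "observable f \<Longrightarrow> observable (\<lambda>A. f A / c)"
  using observable_mult[OF _ observable_const[of "1 / c"]] by simp

lemma observable_exp:
  assumes "observable f"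
  shows "observable (\<lambda>A. exp (f A))"
proof -
  obtain C where "\<forall>A\<in>orth. \<bar>f A\<bar> \<le> C"
    using assms unfolding observable_def by blast
  then have "\<forall>A\<in>orth. \<bar>exp (f A)\<bar> \<le> exp C" by (auto simp: abs_le_iff)
  then show ?thesis using assms unfolding observable_def by auto
qed

lemma observable_if: "observable f \<Longrightarrow> observable g \<Longrightarrow> observable (\<lambda>A. if P then f A else g A)"
  by (cases P) auto

lemma observable_entry:
  assumes "i < N" "j < N"
  shows "observable (\<lambda>A. A $$ (i, j))"
proof -
  have "\<bar>A $$ (i, j)\<bar> \<le> 1" if "A \<in> orth" for A
  proof -
    have "A $$ (i, j) * A $$ (i, j) \<le> (\<Sum>k<N. A $$ (i, k) * A $$ (i, k))"
      using assms by (intro member_le_sum) auto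
    also have "\<dots> = 1" using orthogonal_rows[OF that, of i i] assms by simp
    finally show ?thesis using abs_square_le_1[of "A $$ (i, j)"] by (simp add: power2_eq_square)
  qed
  then show ?thesis
    unfolding observable_def using measurable_orthogonal_borel_entry[OF assms] by auto
qed

lemmas observable_intros = observable_const observable_uminus observable_add observable_diff
  observable_mult observable_sum observable_power observable_divide_const observable_exp
  observable_if observable_entry

definition row_derivative ::
    "nat \<Rightarrow> nat \<Rightarrow> (real mat \<Rightarrow> real) \<Rightarrow> (real mat \<Rightarrow> real) \<Rightarrow> bool" where
  "row_derivative a b f f' \<longleftrightarrow>
     (\<forall>A\<in>orth. ((\<lambda>s. f (rotate_rows N a b s A)) has_real_derivative f' A) (at 0))"

lemma measurable_rotate_rows:
  assumes "a < N" "b < N" "a \<noteq> b"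
  shows "rotate_rows N a b s \<in> measurable \<mu> \<mu>"
proof -
  have "(\<lambda>A. rotate_rows N a b s (1\<^sub>m N) * A) \<in> measurable \<mu> \<mu>"
    using measurable_left_mult[OF rotate_rows_one_orthogonal[OF assms]]
    by (simp add: measurable_cong_sets[OF sets_haar sets_haar])
  then show ?thesis
    by (rule measurable_cong[THEN iffD2, rotated])
      (simp, rule rotate_rows_eq_mult[OF assms orthogonal_carrier])
qed

lemma integral_rotate_rows:
  assumes ab: "a < N" "b < N" "a \<noteq> b" and f: "f \<in> borel_measurable \<mu>"
  shows "(\<integral>A. f (rotate_rows N a b s A) \<partial>\<mu>) = (\<integral>A. f A \<partial>\<mu> :: real)"
proof -
  let ?G = "rotate_rows N a b s (1\<^sub>m N)"
  have "\<mu> = distr \<mu> (orthogonal_borel N) (\<lambda>A. ?G * A)"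
    using haar rotate_rows_one_orthogonal[OF ab] by (simp add: haar_orthogonal_def)
  then have "(\<integral>A. f A \<partial>\<mu>) = (\<integral>A. f A \<partial>distr \<mu> (orthogonal_borel N) (\<lambda>A. ?G * A))"
    by simp
  also have "\<dots> = (\<integral>A. f (?G * A) \<partial>\<mu>)"
    using measurable_left_mult[OF rotate_rows_one_orthogonal[OF ab]] f
    by (intro integral_distr) (simp_all add: measurable_cong_sets[OF sets_haar refl])
  also have "\<dots> = (\<integral>A. f (rotate_rows N a b s A) \<partial>\<mu>)"
    by (intro Bochner_Integration.integral_cong refl)
      (subst (2) rotate_rows_eq_mult[OF ab], auto intro: orthogonal_carrier)
  finally show ?thesis by simp
qed

text \<open>By invariance the integral of \<open>f\<close> over the rotated matrix does not depend
  on the angle; its derivative at 0 is the integral of \<open>f'\<close>.\<close>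

lemma expectation_row_derivative_eq_0:
  assumes ab: "a < N" "b < N" "a \<noteq> b"
    and D: "row_derivative a b f f'" and obs: "observable f" "observable f'"
  shows "(\<integral>A. f' A \<partial>\<mu>) = 0"
proof -
  let ?R = "rotate_rows N a b"
  obtain C where C: "\<forall>A\<in>orth. \<bar>f' A\<bar> \<le> C" using obs unfolding observable_def by blast
  have [measurable]: "f \<in> borel_measurable \<mu>" "f' \<in> borel_measurable \<mu>" "\<And>s. ?R s \<in> measurable \<mu> \<mu>"
    using obs measurable_rotate_rows[OF ab] by (auto simp: observable_def)
  have "((\<lambda>s. \<integral>A. f (?R s A) \<partial>\<mu>) has_real_derivative (\<integral>A. f' (?R 0 A) \<partial>\<mu>)) (at 0)"
  proof (rule DERIV_expectation[where e = 1])
    fix s A assume "A \<in> space \<mu>"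
    then have A: "?R s A \<in> orth" by (simp add: rotate_rows_orthogonal[OF ab])
    show "\<bar>f' (?R s A)\<bar> \<le> C" using A C by simp
    \<comment> \<open>\<open>row_derivative\<close> speaks only of angle 0. Used at the matrix
      already rotated by \<open>s\<close>, it yields the derivative at angle \<open>s\<close>
      through \<open>rotate_rows_add\<close>.\<close>
    have "((\<lambda>t. f (?R t (?R s A))) has_real_derivative f' (?R s A)) (at (s - s))"
      using A D unfolding row_derivative_def by simp
    then have "((\<lambda>t. f (?R (t - s) (?R s A))) has_real_derivative f' (?R s A)) (at s)"
      using DERIV_at_within_shift[of "\<lambda>t. f (?R t (?R s A))" "f' (?R s A)" "-s" s UNIV] by simp
    then show "((\<lambda>s. f (?R s A)) has_real_derivative f' (?R s A)) (at s)"
      by (simp flip: rotate_rows_add[OF ab])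
  next
    fix s
    obtain K where "\<forall>A\<in>orth. \<bar>f A\<bar> \<le> K" using obs unfolding observable_def by blast
    then show "integrable \<mu> (\<lambda>A. f (?R s A))"
      by (intro integrable_const_bound[where B = K])
         (auto simp: rotate_rows_orthogonal[OF ab])
  qed auto
  moreover have "(\<lambda>s. \<integral>A. f (?R s A) \<partial>\<mu>) = (\<lambda>s. \<integral>A. f A \<partial>\<mu>)"
    using integral_rotate_rows[OF ab] by auto
  moreover have "(\<integral>A. f' (?R 0 A) \<partial>\<mu>) = (\<integral>A. f' A \<partial>\<mu>)"
    by (intro Bochner_Integration.integral_cong refl) (simp add: rotate_rows_0[OF ab])
  ultimately show ?thesis
    using DERIV_unique DERIV_const by metis
qed

section \<open>Energies, overlaps and sums of torques\<close>

definition proj :: "real vec \<Rightarrow> real mat \<Rightarrow> nat \<Rightarrow> real" where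
  "proj \<sigma> A i = (\<Sum>a<N. \<sigma> $ a * A $$ (a, i))"

text \<open>With J = A D A^T this is the entry of J at (a, b). In the same notation
  \<open>proj\<close> is A^T sigma, \<open>local_field\<close> is J sigma, and
  \<open>cross_energy\<close> is sigma^T J tau / N.\<close>

definition coupling :: "real mat \<Rightarrow> nat \<Rightarrow> nat \<Rightarrow> real" where
  "coupling A a b = (\<Sum>i<N. d i * A $$ (a, i) * A $$ (b, i))"

definition local_field :: "real vec \<Rightarrow> real mat \<Rightarrow> nat \<Rightarrow> real" where
  "local_field \<sigma> A a = (\<Sum>i<N. d i * A $$ (a, i) * proj \<sigma> A i)"

definition cross_energy :: "real vec \<Rightarrow> real vec \<Rightarrow> real mat \<Rightarrow> real" where
  "cross_energy \<sigma> \<tau> A = (\<Sum>i<N. d i * proj \<sigma> A i * proj \<tau> A i) / N"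

definition energy :: "real vec \<Rightarrow> real mat \<Rightarrow> real" where
  "energy \<sigma> A = cross_energy \<sigma> \<sigma> A"

definition overlap :: "real vec \<Rightarrow> real vec \<Rightarrow> real" where
  "overlap \<sigma> \<tau> = (\<Sum>a<N. \<sigma> $ a * \<tau> $ a) / N"

text \<open>
  Up to the factor \<open>2 / N\<close>, the torque is the derivative of the energy under rotation of the rows
  \<open>a\<close> and \<open>b\<close>, see \<open>row_derivative_energy\<close>; it is also the test function for integration by parts.
\<close>
definition torque :: "real vec \<Rightarrow> real mat \<Rightarrow> nat \<Rightarrow> nat \<Rightarrow> real" where
  "torque \<sigma> A a b = \<sigma> $ a * local_field \<sigma> A b - \<sigma> $ b * local_field \<sigma> A a"

text \<open>The normalised trace of D, and thus of J. It is kept as an explicit error term because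
  the identities are exact at finite N.\<close>

definition imbalance :: real where
  "imbalance = (\<Sum>i<N. d i) / N"

lemma observable_proj: "i < N \<Longrightarrow> observable (\<lambda>A. proj \<sigma> A i)"
  unfolding proj_def by (intro observable_intros) auto

lemma observable_coupling: "a < N \<Longrightarrow> b < N \<Longrightarrow> observable (\<lambda>A. coupling A a b)"
  unfolding coupling_def by (intro observable_intros) auto

lemma observable_local_field: "a < N \<Longrightarrow> observable (\<lambda>A. local_field \<sigma> A a)"
  unfolding local_field_def by (intro observable_intros observable_proj) auto

lemma observable_cross_energy: "observable (\<lambda>A. cross_energy \<sigma> \<tau> A)"
  unfolding cross_energy_def by (intro observable_intros observable_proj) auto

lemma observable_energy: "observable (\<lambda>A. energy \<sigma> A)"
  unfolding energy_def by (rule observable_cross_energy)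

lemma observable_torque: "a < N \<Longrightarrow> b < N \<Longrightarrow> observable (\<lambda>A. torque \<sigma> A a b)"
  unfolding torque_def by (intro observable_intros observable_local_field) auto

lemma sign_square: "i < N \<Longrightarrow> d i * d i = 1"
  using sign[of i] by auto

lemma spin_square: "\<sigma> \<in> spins N \<Longrightarrow> a < N \<Longrightarrow> \<sigma> $ a * \<sigma> $ a = 1"
  unfolding spins_def by auto

lemma sum_proj_proj:
  assumes "A \<in> orth"
  shows "(\<Sum>i<N. proj \<sigma> A i * proj \<tau> A i) = N * overlap \<sigma> \<tau>"
proof -
  have "(\<Sum>i<N. proj \<sigma> A i * proj \<tau> A i)
      = (\<Sum>i<N. \<Sum>a<N. \<Sum>b<N. \<sigma> $ a * \<tau> $ b * (A $$ (a, i) * A $$ (b, i)))"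
    unfolding proj_def sum_product by (intro sum.cong refl) (simp add: mult_ac)
  also have "\<dots> = (\<Sum>a<N. \<Sum>b<N. \<sigma> $ a * \<tau> $ b * (\<Sum>i<N. A $$ (a, i) * A $$ (b, i)))"
    unfolding sum_distrib_left by (subst sum.swap, rule sum.cong[OF refl], rule sum.swap)
  also have "\<dots> = (\<Sum>a<N. \<Sum>b<N. if b = a then \<sigma> $ a * \<tau> $ b else 0)"
    by (intro sum.cong refl) (simp add: orthogonal_rows[OF assms])
  also have "\<dots> = N * overlap \<sigma> \<tau>"
    using N_pos by (simp add: overlap_def)
  finally show ?thesis .
qed

text \<open>J is symmetric and J^2 = A D^2 A^T = 1 since every \<open>d i\<close> is a sign; hence J
  sigma and J tau have the same inner product as sigma and tau.\<close>

lemma sum_field_field: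
  assumes "A \<in> orth"
  shows "(\<Sum>a<N. local_field \<sigma> A a * local_field \<tau> A a) = N * overlap \<sigma> \<tau>"
proof -
  let ?p = "\<lambda>i. d i * proj \<sigma> A i" and ?q = "\<lambda>i. d i * proj \<tau> A i"
  have "(\<Sum>a<N. local_field \<sigma> A a * local_field \<tau> A a)
      = (\<Sum>a<N. \<Sum>i<N. \<Sum>j<N. ?p i * ?q j * (A $$ (a, i) * A $$ (a, j)))"
    unfolding local_field_def sum_product by (intro sum.cong refl) (simp add: mult_ac)
  also have "\<dots> = (\<Sum>i<N. \<Sum>j<N. ?p i * ?q j * (\<Sum>a<N. A $$ (a, i) * A $$ (a, j)))"
    unfolding sum_distrib_left by (subst sum.swap, rule sum.cong[OF refl], rule sum.swap)
  also have "\<dots> = (\<Sum>i<N. \<Sum>j<N. if j = i then ?p i * ?q j else 0)"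
    by (intro sum.cong refl) (simp add: orthogonal_cols[OF assms])
  also have "\<dots> = (\<Sum>i<N. (d i * d i) * (proj \<sigma> A i * proj \<tau> A i))"
    by (simp add: mult_ac)
  also have "\<dots> = (\<Sum>i<N. proj \<sigma> A i * proj \<tau> A i)"
    by (simp add: sign_square)
  finally show ?thesis using sum_proj_proj[OF assms] by simp
qed

lemma sum_spin_field: "(\<Sum>a<N. \<sigma> $ a * local_field \<tau> A a) = N * cross_energy \<sigma> \<tau> A"
proof -
  have "(\<Sum>a<N. \<sigma> $ a * local_field \<tau> A a)
      = (\<Sum>i<N. \<Sum>a<N. d i * proj \<tau> A i * (\<sigma> $ a * A $$ (a, i)))"
    unfolding local_field_def sum_distrib_left by (subst sum.swap) (simp add: mult_ac)
  also have "\<dots> = (\<Sum>i<N. d i * proj \<sigma> A i * proj \<tau> A i)"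
    unfolding sum_distrib_left[symmetric] proj_def[of \<sigma>, symmetric] by (simp add: mult_ac)
  finally show ?thesis using N_pos by (simp add: cross_energy_def)
qed

lemma cross_energy_commute: "cross_energy \<sigma> \<tau> A = cross_energy \<tau> \<sigma> A"
  unfolding cross_energy_def by (simp add: mult_ac)

text \<open>The polarised Lagrange identity for the 2 x 2 minors of (sigma, J sigma) and (tau, J
  tau). The mixed products sigma . J tau and tau . J sigma coincide and give the square of the cross
  energy.\<close>

lemma sum_torque_torque:
  assumes "A \<in> orth"
  shows "(\<Sum>a<N. \<Sum>b<N. torque \<sigma> A a b * torque \<tau> A a b)
    = 2 * (real N)\<^sup>2 * ((overlap \<sigma> \<tau>)\<^sup>2 - (cross_energy \<sigma> \<tau> A)\<^sup>2)"
proof -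
  let ?W = "\<lambda>\<sigma>. local_field \<sigma> A"
  have "(\<Sum>a<N. \<Sum>b<N. torque \<sigma> A a b * torque \<tau> A a b)
    = (\<Sum>a<N. \<Sum>b<N. (\<sigma> $ a * \<tau> $ a) * (?W \<sigma> b * ?W \<tau> b) + (?W \<sigma> a * ?W \<tau> a) * (\<sigma> $ b * \<tau> $ b)
        - (\<sigma> $ a * ?W \<tau> a) * (\<tau> $ b * ?W \<sigma> b) - (\<tau> $ a * ?W \<sigma> a) * (\<sigma> $ b * ?W \<tau> b))"
    unfolding torque_def by (intro sum.cong refl) (simp add: algebra_simps)
  also have "\<dots> = 2 * ((\<Sum>a<N. \<sigma> $ a * \<tau> $ a) * (\<Sum>b<N. ?W \<sigma> b * ?W \<tau> b))
      - 2 * ((\<Sum>a<N. \<sigma> $ a * ?W \<tau> a) * (\<Sum>b<N. \<tau> $ b * ?W \<sigma> b))"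
    by (simp add: sum.distrib sum_subtractf flip: sum_product)
  also have "(\<Sum>a<N. \<sigma> $ a * \<tau> $ a) = N * overlap \<sigma> \<tau>"
    using N_pos by (simp add: overlap_def)
  finally show ?thesis
    by (simp add: sum_field_field[OF assms] sum_spin_field cross_energy_commute[of \<tau>] power2_eq_square algebra_simps)
qed

lemma overlap_self: "\<sigma> \<in> spins N \<Longrightarrow> overlap \<sigma> \<sigma> = 1"
  using N_pos by (simp add: overlap_def spin_square)

lemma abs_energy_le_1:
  assumes "A \<in> orth" "\<sigma> \<in> spins N"
  shows "\<bar>energy \<sigma> A\<bar> \<le> 1"
proof -
  have "\<bar>\<Sum>i<N. d i * proj \<sigma> A i * proj \<sigma> A i\<bar> \<le> (\<Sum>i<N. \<bar>d i * proj \<sigma> A i * proj \<sigma> A i\<bar>)"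
    by (rule sum_abs)
  also have "\<dots> = (\<Sum>i<N. proj \<sigma> A i * proj \<sigma> A i)"
    using sign by (intro sum.cong refl) (force simp: abs_mult)
  also have "\<dots> = N"
    by (simp add: sum_proj_proj[OF assms(1)] overlap_self[OF assms(2)])
  finally show ?thesis
    using N_pos by (simp add: energy_def cross_energy_def)
qed

lemma abs_overlap_le_1:
  assumes "\<sigma> \<in> spins N" "\<tau> \<in> spins N"
  shows "\<bar>overlap \<sigma> \<tau>\<bar> \<le> 1"
proof -
  have "\<bar>\<Sum>a<N. \<sigma> $ a * \<tau> $ a\<bar> \<le> (\<Sum>a<N. \<bar>\<sigma> $ a * \<tau> $ a\<bar>)" by (rule sum_abs)
  also have "\<dots> = (\<Sum>a<N. 1)"
    using assms unfolding spins_def by (intro sum.cong refl) (force simp: abs_mult)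
  finally show ?thesis using N_pos by (simp add: overlap_def)
qed

context
  fixes a b :: nat
  assumes ab: "a < N" "b < N" "a \<noteq> b"
begin

lemma DERIV_entry:
  assumes "A \<in> orth" "c < N" "i < N"
  shows "((\<lambda>s. rotate_rows N a b s A $$ (c, i)) has_real_derivative
     (if c = a then A $$ (b, i) else 0) - (if c = b then A $$ (a, i) else 0)) (at 0)"
  using ab assms by (auto simp: rotate_rows_def intro!: derivative_eq_intros)

lemma DERIV_proj:
  assumes A: "A \<in> orth" and "i < N"
  shows "((\<lambda>s. proj \<sigma> (rotate_rows N a b s A) i) has_real_derivative
     \<sigma> $ a * A $$ (b, i) - \<sigma> $ b * A $$ (a, i)) (at 0)"
proof -
  have "((\<lambda>s. proj \<sigma> (rotate_rows N a b s A) i) has_real_derivative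
     (\<Sum>c<N. \<sigma> $ c * ((if c = a then A $$ (b, i) else 0) - (if c = b then A $$ (a, i) else 0)))) (at 0)"
    unfolding proj_def using assms by (intro DERIV_sum DERIV_cmult DERIV_entry) auto
  moreover have "(\<Sum>c<N. \<sigma> $ c * ((if c = a then A $$ (b, i) else 0) - (if c = b then A $$ (a, i) else 0)))
     = \<sigma> $ a * A $$ (b, i) - \<sigma> $ b * A $$ (a, i)"
    using ab by (simp add: right_diff_distrib sum_subtractf if_distrib[of "(*) _"] cong: if_cong)
  ultimately show ?thesis by simp
qed

lemma DERIV_local_field:
  assumes A: "A \<in> orth" and "c < N"
  shows "((\<lambda>s. local_field \<sigma> (rotate_rows N a b s A) c) has_real_derivative
     (if c = a then local_field \<sigma> A b else 0) - (if c = b then local_field \<sigma> A a else 0)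
     + \<sigma> $ a * coupling A c b - \<sigma> $ b * coupling A c a) (at 0)"
proof -
  note [simp] = rotate_rows_0[OF ab A]
  have "((\<lambda>s. local_field \<sigma> (rotate_rows N a b s A) c) has_real_derivative
     (\<Sum>i<N. d i * ((if c = a then A $$ (b, i) else 0) - (if c = b then A $$ (a, i) else 0)) * proj \<sigma> A i
        + d i * A $$ (c, i) * (\<sigma> $ a * A $$ (b, i) - \<sigma> $ b * A $$ (a, i)))) (at 0)"
    unfolding local_field_def
  proof (rule DERIV_sum)
    fix i assume "i \<in> {..<N}"
    then have i: "i < N" by simp
    show "((\<lambda>s. d i * rotate_rows N a b s A $$ (c, i) * proj \<sigma> (rotate_rows N a b s A) i) has_real_derivative
        d i * ((if c = a then A $$ (b, i) else 0) - (if c = b then A $$ (a, i) else 0)) * proj \<sigma> A i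
        + d i * A $$ (c, i) * (\<sigma> $ a * A $$ (b, i) - \<sigma> $ b * A $$ (a, i))) (at 0)"
      by (rule DERIV_cong[OF DERIV_mult[OF DERIV_cmult[OF DERIV_entry[OF assms i], of "d i"] DERIV_proj[OF A i, of \<sigma>]]])
        simp
  qed
  moreover have "(\<Sum>i<N. d i * ((if c = a then A $$ (b, i) else 0) - (if c = b then A $$ (a, i) else 0)) * proj \<sigma> A i
        + d i * A $$ (c, i) * (\<sigma> $ a * A $$ (b, i) - \<sigma> $ b * A $$ (a, i)))
     = (if c = a then local_field \<sigma> A b else 0) - (if c = b then local_field \<sigma> A a else 0)
     + \<sigma> $ a * coupling A c b - \<sigma> $ b * coupling A c a"
    unfolding local_field_def coupling_def
    by (auto simp: sum.distrib sum_subtractf algebra_simps sum_distrib_left sum_negf)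
  ultimately show ?thesis by simp
qed

lemma row_derivative_energy:
  "row_derivative a b (energy \<sigma>) (\<lambda>A. 2 / N * torque \<sigma> A a b)"
  unfolding row_derivative_def
proof
  fix A assume A: "A \<in> orth"
  note [simp] = rotate_rows_0[OF ab A]
  have "((\<lambda>s. energy \<sigma> (rotate_rows N a b s A)) has_real_derivative
     (\<Sum>i<N. 2 * d i * proj \<sigma> A i * (\<sigma> $ a * A $$ (b, i) - \<sigma> $ b * A $$ (a, i))) / N) (at 0)"
    unfolding energy_def cross_energy_def using A
    by (intro DERIV_cdivide DERIV_sum) (auto intro!: derivative_eq_intros DERIV_proj simp: algebra_simps)
  moreover have "(\<Sum>i<N. 2 * d i * proj \<sigma> A i * (\<sigma> $ a * A $$ (b, i) - \<sigma> $ b * A $$ (a, i))) / N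
      = 2 / N * torque \<sigma> A a b"
    unfolding torque_def local_field_def
    by (simp add: algebra_simps sum_subtractf sum_distrib_left sum_divide_distrib diff_divide_distrib)
  ultimately show "((\<lambda>s. energy \<sigma> (rotate_rows N a b s A)) has_real_derivative 2 / N * torque \<sigma> A a b) (at 0)"
    by simp
qed

end

section \<open>The divergence of the torque and integration by parts\<close>

definition torque_deriv :: "real vec \<Rightarrow> real mat \<Rightarrow> nat \<Rightarrow> nat \<Rightarrow> real" where
  "torque_deriv \<sigma> A a b =
     \<sigma> $ a * (\<sigma> $ a * coupling A b b - \<sigma> $ b * coupling A b a - local_field \<sigma> A a)
     - \<sigma> $ b * (\<sigma> $ a * coupling A a b - \<sigma> $ b * coupling A a a + local_field \<sigma> A b)"

lemma row_derivative_torque: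
  assumes "a < N" "b < N" "a \<noteq> b"
  shows "row_derivative a b (\<lambda>A. torque \<sigma> A a b) (\<lambda>A. torque_deriv \<sigma> A a b)"
  unfolding row_derivative_def torque_def torque_deriv_def using assms
  by (auto intro!: derivative_eq_intros DERIV_local_field simp: algebra_simps)

lemma observable_torque_deriv: "a < N \<Longrightarrow> b < N \<Longrightarrow> observable (\<lambda>A. torque_deriv \<sigma> A a b)"
  unfolding torque_deriv_def by (intro observable_intros observable_coupling observable_local_field) auto

text \<open>The divergence of the torque field. Since each spin squares to 1, the diagonal entries
  of J contribute 2 N times its trace, while the field terms contribute the energy.\<close>

lemma sum_torque_deriv:
  assumes A: "A \<in> orth" and \<sigma>: "\<sigma> \<in> spins N"
  shows "(\<Sum>a<N. \<Sum>b<N. if a = b then 0 else torque_deriv \<sigma> A a b)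
     = 2 * (real N)\<^sup>2 * (imbalance - energy \<sigma> A)"
proof -
  let ?W = "local_field \<sigma> A"
  have "(\<Sum>a<N. \<Sum>b<N. if a = b then 0 else torque_deriv \<sigma> A a b)
      = (\<Sum>a<N. \<Sum>b<N. torque_deriv \<sigma> A a b - (if a = b then torque_deriv \<sigma> A a a else 0))"
    by (intro sum.cong refl) auto
  also have "\<dots> = (\<Sum>a<N. \<Sum>b<N. torque_deriv \<sigma> A a b) - (\<Sum>a<N. torque_deriv \<sigma> A a a)"
    by (simp add: sum_subtractf)
  \<comment> \<open>For a = b the formula does not vanish. Subtracting the diagonal cancels the
    terms of order N in the full sum, so the identity is exact.\<close>
  also have "(\<Sum>a<N. torque_deriv \<sigma> A a a) = - 2 * (N * energy \<sigma> A)"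
    unfolding energy_def sum_spin_field[symmetric]
    by (simp add: torque_deriv_def algebra_simps sum_distrib_left sum_negf)
  also have "(\<Sum>a<N. \<Sum>b<N. torque_deriv \<sigma> A a b) = 2 * (real N * (N * imbalance)) - 2 * (N * energy \<sigma> A)
      - 2 * (real N * (N * energy \<sigma> A))"
  proof -
    have tr: "(\<Sum>a<N. coupling A a a) = N * imbalance"
    proof -
      have "(\<Sum>a<N. coupling A a a) = (\<Sum>i<N. \<Sum>a<N. d i * (A $$ (a, i) * A $$ (a, i)))"
        unfolding coupling_def by (subst sum.swap) (simp add: mult_ac)
      also have "\<dots> = (\<Sum>i<N. d i)"
        unfolding sum_distrib_left[symmetric] by (simp add: orthogonal_cols[OF A])
      finally show ?thesis using N_pos by (simp add: imbalance_def)
    qed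
    have W: "?W a = (\<Sum>b<N. \<sigma> $ b * coupling A a b)" for a
    proof -
      have "?W a = (\<Sum>i<N. \<Sum>b<N. d i * A $$ (a, i) * (\<sigma> $ b * A $$ (b, i)))"
        unfolding local_field_def proj_def sum_distrib_left ..
      also have "\<dots> = (\<Sum>b<N. \<sigma> $ b * coupling A a b)"
        unfolding coupling_def sum_distrib_left by (subst sum.swap) (simp add: mult_ac)
      finally show ?thesis .
    qed
    have q: "(\<Sum>a<N. \<sigma> $ a * (\<Sum>b<N. \<sigma> $ b * coupling A a b)) = N * energy \<sigma> A"
      unfolding energy_def sum_spin_field[symmetric] W ..
    have "coupling A b a = coupling A a b" for a b
      unfolding coupling_def by (simp add: mult_ac)
    then have q': "(\<Sum>a<N. \<sigma> $ a * (\<Sum>b<N. \<sigma> $ b * coupling A b a)) = N * energy \<sigma> A"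
      using q by simp
    have "(\<Sum>a<N. \<Sum>b<N. torque_deriv \<sigma> A a b) = (\<Sum>a<N. \<Sum>b<N. coupling A b b + coupling A a a
        - \<sigma> $ a * (\<sigma> $ b * coupling A b a) - \<sigma> $ a * (\<sigma> $ b * coupling A a b) - \<sigma> $ a * ?W a - \<sigma> $ b * ?W b)"
    proof (intro sum.cong refl)
      fix a b assume "a \<in> {..<N}" "b \<in> {..<N}"
      then have "torque_deriv \<sigma> A a b = (\<sigma> $ a * \<sigma> $ a) * coupling A b b + (\<sigma> $ b * \<sigma> $ b) * coupling A a a
        - \<sigma> $ a * (\<sigma> $ b * coupling A b a) - \<sigma> $ a * (\<sigma> $ b * coupling A a b) - \<sigma> $ a * ?W a - \<sigma> $ b * ?W b"
        unfolding torque_deriv_def by (simp add: algebra_simps)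
      then show "torque_deriv \<sigma> A a b = coupling A b b + coupling A a a
        - \<sigma> $ a * (\<sigma> $ b * coupling A b a) - \<sigma> $ a * (\<sigma> $ b * coupling A a b) - \<sigma> $ a * ?W a - \<sigma> $ b * ?W b"
        using \<open>a \<in> _\<close> \<open>b \<in> _\<close> spin_square[OF \<sigma>] by simp
    qed
    also have "\<dots> = 2 * (real N * (N * imbalance)) - 2 * (N * energy \<sigma> A) - 2 * (real N * (N * energy \<sigma> A))"
      by (simp add: sum.distrib sum_subtractf q q' tr sum_spin_field flip: energy_def sum_distrib_left)
    finally show ?thesis .
  qed
  finally show ?thesis by (simp add: power2_eq_square algebra_simps)
qed

text \<open>In each plane (a, b) the product of the torque and \<open>g\<close> has a derivative of
  mean zero. Summing over all planes turns the first factor of the product rule into the divergence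
  from \<open>sum_torque_deriv\<close>.\<close>

lemma integration_by_parts:
  assumes \<sigma>: "\<sigma> \<in> spins N" and g: "observable g"
    and g': "\<And>a b. a < N \<Longrightarrow> b < N \<Longrightarrow> observable (g' a b)"
    and D: "\<And>a b. a < N \<Longrightarrow> b < N \<Longrightarrow> a \<noteq> b \<Longrightarrow> row_derivative a b g (g' a b)"
  shows "(\<integral>A. 2 * (real N)\<^sup>2 * (imbalance - energy \<sigma> A) * g A
      + (\<Sum>a<N. \<Sum>b<N. torque \<sigma> A a b * g' a b A) \<partial>\<mu>) = 0"
proof -
  define F where "F a b A = torque_deriv \<sigma> A a b * g A + torque \<sigma> A a b * g' a b A" for a b A
  have F: "observable (F a b)" if "a < N" "b < N" for a b
    unfolding F_def[abs_def] using that g g'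
    by (intro observable_intros observable_torque observable_torque_deriv) auto
  have "(\<integral>A. F a b A \<partial>\<mu>) = 0" if "a < N" "b < N" "a \<noteq> b" for a b
  proof (rule expectation_row_derivative_eq_0[OF that])
    show "row_derivative a b (\<lambda>A. torque \<sigma> A a b * g A) (F a b)"
      unfolding row_derivative_def F_def
    proof
      fix A assume A: "A \<in> orth"
      note [simp] = rotate_rows_0[OF that A]
      show "((\<lambda>s. torque \<sigma> (rotate_rows N a b s A) a b * g (rotate_rows N a b s A)) has_real_derivative
          torque_deriv \<sigma> A a b * g A + torque \<sigma> A a b * g' a b A) (at 0)"
        using row_derivative_torque[OF that] D[OF that] A unfolding row_derivative_def
        by (auto intro!: derivative_eq_intros)
    qed
    show "observable (F a b)" using F that by simp
    show "observable (\<lambda>A. torque \<sigma> A a b * g A)"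
      using that g by (intro observable_intros observable_torque) auto
  qed
  then have "(\<integral>A. (if a = b then 0 else F a b A) \<partial>\<mu>) = 0" if "a < N" "b < N" for a b
    using that by (cases "a = b") auto
  then have "0 = (\<Sum>a<N. \<Sum>b<N. \<integral>A. (if a = b then 0 else F a b A) \<partial>\<mu>)"
    by simp
  also have "\<dots> = (\<integral>A. (\<Sum>a<N. \<Sum>b<N. if a = b then 0 else F a b A) \<partial>\<mu>)"
    using F by (subst Bochner_Integration.integral_sum, (auto intro!: observable_integrable observable_intros)[1],
      intro sum.cong refl, subst Bochner_Integration.integral_sum,
      auto intro!: observable_integrable observable_intros)
  also have "\<dots> = (\<integral>A. 2 * (real N)\<^sup>2 * (imbalance - energy \<sigma> A) * g A
      + (\<Sum>a<N. \<Sum>b<N. torque \<sigma> A a b * g' a b A) \<partial>\<mu>)"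
  proof (intro Bochner_Integration.integral_cong refl)
    fix A assume "A \<in> space \<mu>"
    then have A: "A \<in> orth" by simp
    \<comment> \<open>The torque vanishes for a = b, so the second summand may run over the diagonal
      as well.\<close>
    have "(\<Sum>a<N. \<Sum>b<N. if a = b then 0 else F a b A) =
      (\<Sum>a<N. \<Sum>b<N. (if a = b then 0 else torque_deriv \<sigma> A a b) * g A + torque \<sigma> A a b * g' a b A)"
      unfolding F_def by (intro sum.cong refl) (auto simp: torque_def)
    then show "(\<Sum>a<N. \<Sum>b<N. if a = b then 0 else F a b A) = 2 * (real N)\<^sup>2 * (imbalance - energy \<sigma> A) * g A
      + (\<Sum>a<N. \<Sum>b<N. torque \<sigma> A a b * g' a b A)"
      using sum_torque_deriv[OF A \<sigma>] by (simp add: sum.distrib flip: sum_distrib_right)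
  qed
  finally show ?thesis by simp
qed

text \<open>Integration by parts against the Boltzmann weight of two replicas, whose derivative
  produces products of torques. The case \<open>t = 0\<close> serves a single replica, and equal
  parameters serve a pair.\<close>

lemma annealed_identity:
  assumes \<sigma>: "\<sigma> \<in> spins N" "\<tau> \<in> spins N"
  shows "(\<integral>A. (imbalance - energy \<sigma> A + 2 * s * (1 - (energy \<sigma> A)\<^sup>2)
      + 2 * t * ((overlap \<sigma> \<tau>)\<^sup>2 - (cross_energy \<sigma> \<tau> A)\<^sup>2)) * exp (N * (s * energy \<sigma> A + t * energy \<tau> A)) \<partial>\<mu>) = 0"
proof -
  let ?g = "\<lambda>A. exp (N * (s * energy \<sigma> A + t * energy \<tau> A))"
  let ?g' = "\<lambda>a b A. 2 * (s * torque \<sigma> A a b + t * torque \<tau> A a b) * ?g A"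
  have "(\<integral>A. 2 * (real N)\<^sup>2 * (imbalance - energy \<sigma> A) * ?g A
      + (\<Sum>a<N. \<Sum>b<N. torque \<sigma> A a b * ?g' a b A) \<partial>\<mu>) = 0"
  proof (rule integration_by_parts[OF \<sigma>(1)])
    fix a b assume "a < N" "b < N" "a \<noteq> b"
    note ab = this
    show "row_derivative a b ?g (?g' a b)"
      unfolding row_derivative_def
    proof
      fix A assume A: "A \<in> orth"
      note [simp] = rotate_rows_0[OF ab A]
      show "((\<lambda>r. ?g (rotate_rows N a b r A)) has_real_derivative ?g' a b A) (at 0)"
        using row_derivative_energy[OF ab] A N_pos unfolding row_derivative_def
        by (auto intro!: derivative_eq_intros simp: field_simps)
    qed
  qed (auto intro!: observable_intros observable_energy observable_torque)
  also have "(\<integral>A. 2 * (real N)\<^sup>2 * (imbalance - energy \<sigma> A) * ?g A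
      + (\<Sum>a<N. \<Sum>b<N. torque \<sigma> A a b * ?g' a b A) \<partial>\<mu>) =
    (\<integral>A. 2 * (real N)\<^sup>2 * ((imbalance - energy \<sigma> A + 2 * s * (1 - (energy \<sigma> A)\<^sup>2)
      + 2 * t * ((overlap \<sigma> \<tau>)\<^sup>2 - (cross_energy \<sigma> \<tau> A)\<^sup>2)) * ?g A) \<partial>\<mu>)"
  proof (intro Bochner_Integration.integral_cong refl)
    fix A assume "A \<in> space \<mu>"
    then have A: "A \<in> orth" by simp
    have "(\<Sum>a<N. \<Sum>b<N. torque \<sigma> A a b * ?g' a b A) =
       2 * s * ?g A * (\<Sum>a<N. \<Sum>b<N. torque \<sigma> A a b * torque \<sigma> A a b)
      + 2 * t * ?g A * (\<Sum>a<N. \<Sum>b<N. torque \<sigma> A a b * torque \<tau> A a b)"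
      unfolding sum_distrib_left sum.distrib[symmetric] by (intro sum.cong refl) (simp add: algebra_simps)
    then show "2 * (real N)\<^sup>2 * (imbalance - energy \<sigma> A) * ?g A
      + (\<Sum>a<N. \<Sum>b<N. torque \<sigma> A a b * ?g' a b A) = 2 * (real N)\<^sup>2 * ((imbalance - energy \<sigma> A + 2 * s * (1 - (energy \<sigma> A)\<^sup>2)
      + 2 * t * ((overlap \<sigma> \<tau>)\<^sup>2 - (cross_energy \<sigma> \<tau> A)\<^sup>2)) * ?g A)"
      by (simp add: sum_torque_torque[OF A] overlap_self[OF \<sigma>(1)] energy_def[symmetric] algebra_simps)
  qed
  finally show ?thesis using N_pos by simp
qed

section \<open>Gibbs weights and the quenched identity\<close>

definition partition_sum :: "real \<Rightarrow> real mat \<Rightarrow> real" where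
  "partition_sum t A = (\<Sum>\<sigma>\<in>spins N. exp (t * N * energy \<sigma> A))"

definition gibbs :: "real \<Rightarrow> real mat \<Rightarrow> real vec \<Rightarrow> real" where
  "gibbs t A \<sigma> = exp (t * N * energy \<sigma> A) / partition_sum t A"

lemma spins_nonempty: "spins N \<noteq> {}"
  using card_spins[of N] by force

lemma partition_sum_pos: "0 < partition_sum t A"
  unfolding partition_sum_def using finite_spins spins_nonempty by (intro sum_pos) auto

lemma sum_gibbs: "(\<Sum>\<sigma>\<in>spins N. gibbs t A \<sigma>) = 1"
  unfolding gibbs_def sum_divide_distrib[symmetric] partition_sum_def[symmetric]
  using partition_sum_pos[of t A] by simp

lemma gibbs_nonneg: "0 \<le> gibbs t A \<sigma>"
  unfolding gibbs_def using partition_sum_pos[of t A] by simp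

lemma gibbs_le_1: "\<sigma> \<in> spins N \<Longrightarrow> gibbs t A \<sigma> \<le> 1"
  using member_le_sum[of \<sigma> "spins N" "gibbs t A"] gibbs_nonneg finite_spins sum_gibbs by auto

lemma observable_partition_sum: "observable (partition_sum t)"
  unfolding partition_sum_def[abs_def] by (intro observable_intros observable_energy)

lemma observable_gibbs:
  assumes "\<sigma> \<in> spins N"
  shows "observable (\<lambda>A. gibbs t A \<sigma>)"
proof -
  have "\<bar>gibbs t A \<sigma>\<bar> \<le> 1" for A using gibbs_le_1[OF assms] gibbs_nonneg by simp
  moreover have "(\<lambda>A. gibbs t A \<sigma>) \<in> borel_measurable \<mu>"
    unfolding gibbs_def using observable_partition_sum[of t] observable_energy[of \<sigma>]
    by (auto dest!: observable_measurable)
  ultimately show ?thesis unfolding observable_def by blast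
qed

text \<open>Integration by parts against the Gibbs weight of sigma, summed over sigma.
  Differentiating the normalisation of the weight creates an independent second replica; this is
  where the overlap comes from.\<close>

lemma quenched_identity:
  "(\<integral>A. (\<Sum>\<sigma>\<in>spins N. gibbs t A \<sigma> * (imbalance - energy \<sigma> A + 2 * t * (1 - (energy \<sigma> A)\<^sup>2)))
     - 2 * t * (\<Sum>\<sigma>\<in>spins N. \<Sum>\<tau>\<in>spins N. gibbs t A \<sigma> * gibbs t A \<tau> *
         ((overlap \<sigma> \<tau>)\<^sup>2 - (cross_energy \<sigma> \<tau> A)\<^sup>2)) \<partial>\<mu>) = 0"
proof -
  let ?g' = "\<lambda>\<sigma> a b A. 2 * t * gibbs t A \<sigma> * (torque \<sigma> A a b - (\<Sum>\<tau>\<in>spins N. gibbs t A \<tau> * torque \<tau> A a b))"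
  let ?I = "\<lambda>\<sigma> A. 2 * (real N)\<^sup>2 * (imbalance - energy \<sigma> A) * gibbs t A \<sigma>
      + (\<Sum>a<N. \<Sum>b<N. torque \<sigma> A a b * ?g' \<sigma> a b A)"
  let ?J = "\<lambda>A. (\<Sum>\<sigma>\<in>spins N. gibbs t A \<sigma> * (imbalance - energy \<sigma> A + 2 * t * (1 - (energy \<sigma> A)\<^sup>2)))
     - 2 * t * (\<Sum>\<sigma>\<in>spins N. \<Sum>\<tau>\<in>spins N. gibbs t A \<sigma> * gibbs t A \<tau> *
         ((overlap \<sigma> \<tau>)\<^sup>2 - (cross_energy \<sigma> \<tau> A)\<^sup>2))"
  have I0: "(\<integral>A. ?I \<sigma> A \<partial>\<mu>) = 0" if \<sigma>: "\<sigma> \<in> spins N" for \<sigma>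
  proof (rule integration_by_parts[OF \<sigma>])
    fix a b assume "a < N" "b < N" "a \<noteq> b"
    note ab = this
    show "row_derivative a b (\<lambda>A. gibbs t A \<sigma>) (?g' \<sigma> a b)"
      unfolding row_derivative_def
    proof
      fix A assume A: "A \<in> orth"
      note [simp] = rotate_rows_0[OF ab A]
      let ?R = "\<lambda>r. rotate_rows N a b r A"
      have e: "((\<lambda>r. exp (t * N * energy \<tau> (?R r))) has_real_derivative
          exp (t * N * energy \<tau> A) * (2 * t * torque \<tau> A a b)) (at 0)" for \<tau>
        using row_derivative_energy[OF ab] A N_pos unfolding row_derivative_def
        by (auto intro!: derivative_eq_intros simp: field_simps)
      have Z: "((\<lambda>r. partition_sum t (?R r)) has_real_derivative
          (\<Sum>\<tau>\<in>spins N. exp (t * N * energy \<tau> A) * (2 * t * torque \<tau> A a b))) (at 0)"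
        unfolding partition_sum_def by (intro DERIV_sum e)
      have "(\<Sum>\<tau>\<in>spins N. exp (t * N * energy \<tau> A) * (2 * t * torque \<tau> A a b))
          = partition_sum t A * (2 * t * (\<Sum>\<tau>\<in>spins N. gibbs t A \<tau> * torque \<tau> A a b))"
        unfolding gibbs_def sum_distrib_left using partition_sum_pos[of t A] by (simp add: mult_ac)
      then show "((\<lambda>r. gibbs t (?R r) \<sigma>) has_real_derivative ?g' \<sigma> a b A) (at 0)"
        using partition_sum_pos[of t A] unfolding gibbs_def[of t _ \<sigma>]
        by (intro DERIV_cong[OF DERIV_divide[OF e Z]]) (auto simp: field_simps)
    qed
  qed (auto intro!: observable_intros observable_gibbs observable_torque \<sigma>)
  have "0 = (\<Sum>\<sigma>\<in>spins N. \<integral>A. ?I \<sigma> A \<partial>\<mu>)" using I0 by simp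
  also have "\<dots> = (\<integral>A. (\<Sum>\<sigma>\<in>spins N. ?I \<sigma> A) \<partial>\<mu>)"
    by (subst Bochner_Integration.integral_sum)
      (auto intro!: observable_integrable observable_intros observable_gibbs observable_torque observable_energy)
  also have "\<dots> = (\<integral>A. 2 * (real N)\<^sup>2 * ?J A \<partial>\<mu>)"
  proof (intro Bochner_Integration.integral_cong refl)
    fix A assume "A \<in> space \<mu>"
    then have A: "A \<in> orth" by simp
    let ?p = "gibbs t A"
    have T: "(\<Sum>a<N. \<Sum>b<N. torque \<sigma> A a b * ?g' \<sigma> a b A) =
       2 * t * ?p \<sigma> * ((\<Sum>a<N. \<Sum>b<N. torque \<sigma> A a b * torque \<sigma> A a b)
        - (\<Sum>\<tau>\<in>spins N. ?p \<tau> * (\<Sum>a<N. \<Sum>b<N. torque \<sigma> A a b * torque \<tau> A a b)))" for \<sigma>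
    proof -
      have "(\<Sum>\<tau>\<in>spins N. ?p \<tau> * (\<Sum>a<N. \<Sum>b<N. torque \<sigma> A a b * torque \<tau> A a b))
        = (\<Sum>a<N. \<Sum>b<N. \<Sum>\<tau>\<in>spins N. torque \<sigma> A a b * (?p \<tau> * torque \<tau> A a b))"
        unfolding sum_distrib_left
        by (subst sum.swap, rule sum.cong[OF refl], subst sum.swap, intro sum.cong refl) (simp add: mult_ac)
      then show ?thesis
        by (simp add: sum_distrib_left sum_subtractf algebra_simps)
    qed
    have "?I \<sigma> A = 2 * (real N)\<^sup>2 * (?p \<sigma> * (imbalance - energy \<sigma> A + 2 * t * (1 - (energy \<sigma> A)\<^sup>2))
       - 2 * t * (\<Sum>\<tau>\<in>spins N. ?p \<sigma> * ?p \<tau> * ((overlap \<sigma> \<tau>)\<^sup>2 - (cross_energy \<sigma> \<tau> A)\<^sup>2)))"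
      if "\<sigma> \<in> spins N" for \<sigma>
      unfolding T sum_torque_torque[OF A] overlap_self[OF that] energy_def[symmetric]
      by (simp add: sum_distrib_left sum_subtractf algebra_simps)
    then have "(\<Sum>\<sigma>\<in>spins N. ?I \<sigma> A) = (\<Sum>\<sigma>\<in>spins N. 2 * (real N)\<^sup>2 * (?p \<sigma> * (imbalance - energy \<sigma> A + 2 * t * (1 - (energy \<sigma> A)\<^sup>2))
       - 2 * t * (\<Sum>\<tau>\<in>spins N. ?p \<sigma> * ?p \<tau> * ((overlap \<sigma> \<tau>)\<^sup>2 - (cross_energy \<sigma> \<tau> A)\<^sup>2))))"
      by (intro sum.cong refl) simp
    then show "(\<Sum>\<sigma>\<in>spins N. ?I \<sigma> A) = 2 * (real N)\<^sup>2 * ?J A"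
      by (simp add: sum_subtractf flip: sum_distrib_left)
  qed
  finally show ?thesis using N_pos by simp
qed

end

text \<open>Expansion of the quadratic around its root \<open>rom_slope t\<close>. For t >= 0 the
  slope there is at least 1 and the curvature is nonnegative, so the quadratic lies above its
  tangent.\<close>

lemma rom_drift:
  "x - 2 * t * (1 - x\<^sup>2) = (x - rom_slope t) * (1 + 4 * (t * rom_slope t)) + 2 * t * (x - rom_slope t)\<^sup>2"
  using rom_slope_fixed_point[of t] by (simp add: power2_eq_square algebra_simps)

lemma sum_spins_prod:
  fixes f :: "nat \<Rightarrow> real \<Rightarrow> real"
  shows "(\<Sum>\<tau>\<in>spins N. \<Prod>a<N. f a (\<tau> $ a)) = (\<Prod>a<N. f a (- 1) + f a 1)"
proof -
  have inj: "inj_on (\<lambda>f. vec N f) ({..<N} \<rightarrow>\<^sub>E {-1, 1 :: real})"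
  proof (rule inj_onI)
    fix f g assume fg: "f \<in> {..<N} \<rightarrow>\<^sub>E {-1, 1 :: real}" "g \<in> {..<N} \<rightarrow>\<^sub>E {-1, 1 :: real}"
      and eq: "vec N f = vec N g"
    have "f i = g i" if "i < N" for i
      using arg_cong[OF eq, of "\<lambda>v. v $ i"] that by simp
    then show "f = g" using fg by (intro PiE_ext[of f _ _ g]) auto
  qed
  have "(\<Sum>\<tau>\<in>spins N. \<Prod>a<N. f a (\<tau> $ a)) = (\<Sum>g\<in>{..<N} \<rightarrow>\<^sub>E {-1, 1}. \<Prod>a<N. f a (g a))"
    unfolding spins_eq_image by (simp add: sum.reindex[OF inj])
  also have "\<dots> = (\<Prod>a<N. \<Sum>y\<in>{-1, 1}. f a y)"
    by (rule prod_sum_PiE[symmetric]) auto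
  finally show ?thesis by simp
qed

lemma mat_diag_mult_vec_index:
  fixes z :: "real vec"
  assumes "z \<in> carrier_vec n" "i < n"
  shows "(mat_diag n f *\<^sub>v z) $ i = f i * z $ i"
proof -
  have "(mat_diag n f *\<^sub>v z) $ i = (\<Sum>j<n. (if i = j then f j else 0) * z $ j)"
    using assms by (simp add: scalar_prod_def atLeast0LessThan mat_diag_def)
  also have "\<dots> = (\<Sum>j<n. if j = i then f i * z $ i else 0)"
    by (intro sum.cong refl) auto
  finally show ?thesis using assms by simp
qed

lemma (in prob_space) expectation_pos:
  fixes u :: "'a \<Rightarrow> real"
  assumes "integrable M u" "\<And>x. x \<in> space M \<Longrightarrow> 0 < u x"
  shows "0 < expectation u"
proof -
  have "expectation (\<lambda>_. 0) < expectation u"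
    using assms by (intro integral_less_AE_space) (auto simp: emeasure_space_1)
  then show ?thesis by simp
qed

text \<open>Jensen's inequality through the tangent of ln at the mean of \<open>u\<close>. Having
  \<open>f\<close> below \<open>ln (u x)\<close> lets a pointwise Jensen step inside the Gibbs
  measure be chained with this one.\<close>

lemma (in prob_space) integral_le_ln_integral:
  fixes f u :: "'a \<Rightarrow> real"
  assumes "integrable M f" "integrable M u"
    and "\<And>x. x \<in> space M \<Longrightarrow> 0 < u x" "\<And>x. x \<in> space M \<Longrightarrow> f x \<le> ln (u x)"
  shows "expectation f \<le> ln (expectation u)"
proof -
  have c: "0 < expectation u"
    using assms by (intro expectation_pos)
  have "expectation f \<le> expectation (\<lambda>x. u x / expectation u - 1 + ln (expectation u))"
  proof (rule integral_mono)
    fix x assume x: "x \<in> space M"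
    have "ln (u x / expectation u) \<le> u x / expectation u - 1"
      using assms(3)[OF x] c by (intro ln_le_minus_one) simp
    then show "f x \<le> u x / expectation u - 1 + ln (expectation u)"
      using assms(3,4)[OF x] c by (simp add: ln_div)
  qed (use assms in auto)
  also have "\<dots> = ln (expectation u)"
    using c assms(2) by (simp add: prob_space)
  finally show ?thesis .
qed

section \<open>Annealed bounds\<close>

context haar_signs
begin

lemma measure_orth [simp]: "measure \<mu> orth = 1"
  using prob_space by simp

text \<open>The last hypothesis says that the mean of \<open>h\<close> under the tilt by
  \<open>s\<close> is at most \<open>c s\<close>. It makes the moment times
  \<open>exp (- C s)\<close> nonincreasing in \<open>s\<close>.\<close>

lemma exp_moment_le:
  assumes h: "observable h" and "0 \<le> t" and "C 0 = 0"
    and C: "\<And>s. (C has_real_derivative c s) (at s)"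
    and le: "\<And>s. 0 \<le> s \<Longrightarrow> s \<le> t \<Longrightarrow> (\<integral>A. (h A - c s) * exp (s * h A) \<partial>\<mu>) \<le> 0"
  shows "(\<integral>A. exp (t * h A) \<partial>\<mu>) \<le> exp (C t)"
proof -
  obtain K where K: "\<And>A. A \<in> orth \<Longrightarrow> \<bar>h A\<bar> \<le> K" using h unfolding observable_def by blast
  define M where "M s = (\<integral>A. exp (s * h A) \<partial>\<mu>)" for s
  have int: "integrable \<mu> (\<lambda>A. exp (s * h A))" "integrable \<mu> (\<lambda>A. h A * exp (s * h A))" for s
    by (auto intro!: observable_integrable observable_intros h)
  have M': "(M has_real_derivative (\<integral>A. h A * exp (s * h A) \<partial>\<mu>)) (at s)" for s
    unfolding M_def
  proof (rule DERIV_expectation[where e = 1 and C = "K * exp ((\<bar>s\<bar> + 1) * K)"])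
    fix r A assume r: "\<bar>r - s\<bar> < 1" and "A \<in> space \<mu>"
    then have A: "\<bar>h A\<bar> \<le> K" using K by simp
    show "((\<lambda>s. exp (s * h A)) has_real_derivative h A * exp (r * h A)) (at r)"
      by (auto intro!: derivative_eq_intros)
    have "r * h A \<le> \<bar>r\<bar> * \<bar>h A\<bar>" by (metis abs_ge_self abs_mult)
    also have "\<dots> \<le> (\<bar>s\<bar> + 1) * K" using r A by (intro mult_mono) auto
    finally show "\<bar>h A * exp (r * h A)\<bar> \<le> K * exp ((\<bar>s\<bar> + 1) * K)"
      using A by (auto simp: abs_mult intro!: mult_mono)
  qed (use int in \<open>auto dest: borel_measurable_integrable\<close>)
  have "(\<lambda>s. M s * exp (- C s)) t \<le> (\<lambda>s. M s * exp (- C s)) 0"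
  proof (rule DERIV_nonpos_imp_nonincreasing[OF \<open>0 \<le> t\<close>])
    fix s assume s: "0 \<le> s" "s \<le> t"
    have "((\<lambda>s. M s * exp (- C s)) has_real_derivative
        ((\<integral>A. h A * exp (s * h A) \<partial>\<mu>) - c s * M s) * exp (- C s)) (at s)"
      by (auto intro!: derivative_eq_intros M' C simp: algebra_simps)
    moreover have "(\<integral>A. h A * exp (s * h A) \<partial>\<mu>) - c s * M s \<le> 0"
      using le[OF s] int[of s] by (simp add: M_def left_diff_distrib)
    ultimately show "\<exists>y. ((\<lambda>s. M s * exp (- C s)) has_real_derivative y) (at s) \<and> y \<le> 0"
      by (intro exI conjI) (assumption, simp add: mult_nonpos_nonneg)
  qed
  then have "M t * exp (- C t) \<le> 1" using \<open>C 0 = 0\<close> by (simp add: M_def prob_space)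
  then show ?thesis unfolding M_def by (simp add: exp_minus field_simps)
qed

text \<open>Converts a bound on the mean of the quadratic drift, under the unnormalised weight
  \<open>g\<close>, into one on the mean of \<open>x\<close>: by convexity the drift is at least m
  (x - q) with m >= 1, and m k >= k absorbs the error \<open>k\<close>.\<close>

lemma drift_bound:
  assumes x: "observable x" and g: "observable g" "\<And>A. 0 \<le> g A" and s: "0 \<le> s" and k: "0 \<le> k"
    and le: "(\<integral>A. (x A - 2 * s * (1 - (x A)\<^sup>2) - k) * g A \<partial>\<mu>) \<le> 0"
  shows "(\<integral>A. (x A - (rom_slope s + k)) * g A \<partial>\<mu>) \<le> 0"
proof -
  let ?q = "rom_slope s"
  define m where "m = 1 + 4 * (s * ?q)"
  have m: "1 \<le> m" using rom_slope_sign[of s] by (simp add: m_def)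
  have "m * (\<integral>A. (x A - (?q + k)) * g A \<partial>\<mu>) = (\<integral>A. m * ((x A - (?q + k)) * g A) \<partial>\<mu>)"
    by simp
  also have "\<dots> \<le> (\<integral>A. (x A - 2 * s * (1 - (x A)\<^sup>2) - k) * g A \<partial>\<mu>)"
  proof (rule integral_mono)
    fix A
    have "m * (x A - ?q) \<le> x A - 2 * s * (1 - (x A)\<^sup>2)"
      unfolding rom_drift m_def using s by (simp add: algebra_simps)
    moreover have "k \<le> m * k" using m k by (simp add: mult_le_cancel_right1)
    ultimately have "m * (x A - (?q + k)) \<le> x A - 2 * s * (1 - (x A)\<^sup>2) - k"
      by (simp add: algebra_simps)
    from mult_right_mono[OF this g(2)[of A]]
    show "m * ((x A - (?q + k)) * g A) \<le> (x A - 2 * s * (1 - (x A)\<^sup>2) - k) * g A"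
      by (simp add: mult.assoc)
  qed (auto intro!: observable_integrable observable_intros x g)
  finally have "m * (\<integral>A. (x A - (?q + k)) * g A \<partial>\<mu>) \<le> 0" using le by linarith
  then show ?thesis using m by (simp add: mult_le_0_iff)
qed

text \<open>Passing from x to -x reverses the sign of the imbalance and keeps the form of the drift.
  The sign \<open>e\<close> thus yields negative tilts although \<open>drift_bound\<close> asks for
  a nonnegative parameter; \<open>annealed_square_bound\<close> needs them when t + h is
  negative.\<close>

lemma annealed_bound_signed:
  fixes t :: real
  assumes \<sigma>: "\<sigma> \<in> spins N" and e: "e = 1 \<or> e = - 1" and t: "0 \<le> t"
  shows "(\<integral>A. exp (t * (N * (e * energy \<sigma> A))) \<partial>\<mu>) \<le> exp (N * (rom_energy t + t * \<bar>imbalance\<bar>))"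
proof (rule exp_moment_le[where c = "\<lambda>s. N * (rom_slope s + \<bar>imbalance\<bar>)"])
  fix s :: real assume s: "0 \<le> s" "s \<le> t"
  let ?x = "\<lambda>A. e * energy \<sigma> A" and ?g = "\<lambda>A. exp (s * (N * (e * energy \<sigma> A)))"
  have ee: "e * e = 1" using e by auto
  have "(\<integral>A. (?x A - 2 * s * (1 - (?x A)\<^sup>2) - \<bar>imbalance\<bar>) * ?g A \<partial>\<mu>)
     \<le> (\<integral>A. - e * ((imbalance - energy \<sigma> A + 2 * (e * s) * (1 - (energy \<sigma> A)\<^sup>2)
      + 2 * 0 * ((overlap \<sigma> \<sigma>)\<^sup>2 - (cross_energy \<sigma> \<sigma> A)\<^sup>2)) * exp (N * ((e * s) * energy \<sigma> A + 0 * energy \<sigma> A))) \<partial>\<mu>)"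
  proof (rule integral_mono)
    fix A
    have "- e * imbalance \<ge> - \<bar>imbalance\<bar>" using e by auto
    moreover have "- e * (imbalance - energy \<sigma> A + 2 * (e * s) * (1 - (energy \<sigma> A)\<^sup>2))
      = - e * imbalance + e * energy \<sigma> A - 2 * ((e * e) * s) * (1 - (e * e) * (energy \<sigma> A)\<^sup>2)"
      using e by (auto simp: algebra_simps)
    ultimately have "?x A - 2 * s * (1 - (?x A)\<^sup>2) - \<bar>imbalance\<bar> \<le>
       - e * (imbalance - energy \<sigma> A + 2 * (e * s) * (1 - (energy \<sigma> A)\<^sup>2))"
      using ee by (simp add: power_mult_distrib power2_eq_square[of e])
    from mult_right_mono[OF this, of "?g A"]
    show "(?x A - 2 * s * (1 - (?x A)\<^sup>2) - \<bar>imbalance\<bar>) * ?g A \<le> - e * ((imbalance - energy \<sigma> A + 2 * (e * s) * (1 - (energy \<sigma> A)\<^sup>2)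
      + 2 * 0 * ((overlap \<sigma> \<sigma>)\<^sup>2 - (cross_energy \<sigma> \<sigma> A)\<^sup>2)) * exp (N * ((e * s) * energy \<sigma> A + 0 * energy \<sigma> A)))"
      by (simp add: mult_ac)
  qed (auto intro!: observable_integrable observable_intros observable_energy observable_cross_energy)
  also have "\<dots> = 0"
    using annealed_identity[OF \<sigma> \<sigma>, of "e * s" 0] by (simp only: integral_mult_right_zero mult_zero_right)
  finally have "(\<integral>A. (?x A - (rom_slope s + \<bar>imbalance\<bar>)) * ?g A \<partial>\<mu>) \<le> 0"
    by (intro drift_bound) (auto intro!: observable_intros observable_energy s)
  then have "N * (\<integral>A. (?x A - (rom_slope s + \<bar>imbalance\<bar>)) * ?g A \<partial>\<mu>) \<le> 0"
    by (simp add: mult_nonneg_nonpos)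
  then show "(\<integral>A. (N * ?x A - N * (rom_slope s + \<bar>imbalance\<bar>)) * ?g A \<partial>\<mu>) \<le> 0"
    by (simp add: mult.assoc flip: right_diff_distrib integral_mult_right_zero)
qed (auto intro!: observable_intros observable_energy t derivative_eq_intros DERIV_rom_energy)

lemma annealed_bound:
  fixes t :: real
  assumes \<sigma>: "\<sigma> \<in> spins N"
  shows "(\<integral>A. exp (t * N * energy \<sigma> A) \<partial>\<mu>) \<le> exp (N * (rom_energy t + \<bar>t\<bar> * \<bar>imbalance\<bar>))"
proof (cases "0 \<le> t")
  case True
  then show ?thesis using annealed_bound_signed[OF \<sigma>, of 1 t] by (simp add: mult.assoc)
next
  case False
  then show ?thesis using annealed_bound_signed[OF \<sigma>, of "-1" "- t"] by (simp add: mult.assoc)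
qed

text \<open>The overlap raises the drift of each replica by 2 s r^2, which integrates to t^2 r^2.
  The squared cross energy only lowers the drift and is discarded.\<close>

lemma annealed_pair_bound:
  fixes t :: real
  assumes \<sigma>: "\<sigma> \<in> spins N" and \<tau>: "\<tau> \<in> spins N" and t: "0 \<le> t"
  shows "(\<integral>A. exp (t * N * (energy \<sigma> A + energy \<tau> A)) \<partial>\<mu>)
    \<le> exp (2 * N * (rom_energy t + t * \<bar>imbalance\<bar> + t\<^sup>2 * (overlap \<sigma> \<tau>)\<^sup>2))"
proof -
  have half: "(\<integral>A. (energy \<sigma> A - (rom_slope s + (\<bar>imbalance\<bar> + 2 * s * (overlap \<sigma> \<tau>)\<^sup>2)))
      * exp (s * (N * (energy \<sigma> A + energy \<tau> A))) \<partial>\<mu>) \<le> 0"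
    if \<sigma>: "\<sigma> \<in> spins N" and \<tau>: "\<tau> \<in> spins N" and s: "0 \<le> s" for \<sigma> \<tau> s
  proof (rule drift_bound)
    let ?g = "\<lambda>A. exp (s * (N * (energy \<sigma> A + energy \<tau> A)))"
    have "(\<integral>A. (energy \<sigma> A - 2 * s * (1 - (energy \<sigma> A)\<^sup>2) - (\<bar>imbalance\<bar> + 2 * s * (overlap \<sigma> \<tau>)\<^sup>2)) * ?g A \<partial>\<mu>)
      \<le> (\<integral>A. - ((imbalance - energy \<sigma> A + 2 * s * (1 - (energy \<sigma> A)\<^sup>2)
      + 2 * s * ((overlap \<sigma> \<tau>)\<^sup>2 - (cross_energy \<sigma> \<tau> A)\<^sup>2)) * exp (N * (s * energy \<sigma> A + s * energy \<tau> A))) \<partial>\<mu>)"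
    proof (rule integral_mono)
      fix A
      have "0 \<le> 2 * s * (cross_energy \<sigma> \<tau> A)\<^sup>2" using s by simp
      then have "energy \<sigma> A - 2 * s * (1 - (energy \<sigma> A)\<^sup>2) - (\<bar>imbalance\<bar> + 2 * s * (overlap \<sigma> \<tau>)\<^sup>2)
        \<le> - (imbalance - energy \<sigma> A + 2 * s * (1 - (energy \<sigma> A)\<^sup>2)
      + 2 * s * ((overlap \<sigma> \<tau>)\<^sup>2 - (cross_energy \<sigma> \<tau> A)\<^sup>2))"
        by (simp add: algebra_simps)
      from mult_right_mono[OF this, of "?g A"]
      show "(energy \<sigma> A - 2 * s * (1 - (energy \<sigma> A)\<^sup>2) - (\<bar>imbalance\<bar> + 2 * s * (overlap \<sigma> \<tau>)\<^sup>2)) * ?g A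
        \<le> - ((imbalance - energy \<sigma> A + 2 * s * (1 - (energy \<sigma> A)\<^sup>2)
      + 2 * s * ((overlap \<sigma> \<tau>)\<^sup>2 - (cross_energy \<sigma> \<tau> A)\<^sup>2)) * exp (N * (s * energy \<sigma> A + s * energy \<tau> A)))"
        by (simp only: distrib_left mult.left_commute[of s] minus_mult_left exp_ge_zero)
    qed (auto intro!: observable_integrable observable_intros observable_energy observable_cross_energy)
    also have "\<dots> = 0"
      using annealed_identity[OF \<sigma> \<tau>, of s s] by (simp only: Bochner_Integration.integral_minus minus_zero)
    finally show "(\<integral>A. (energy \<sigma> A - 2 * s * (1 - (energy \<sigma> A)\<^sup>2) - (\<bar>imbalance\<bar> + 2 * s * (overlap \<sigma> \<tau>)\<^sup>2)) * ?g A \<partial>\<mu>) \<le> 0" .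
  qed (auto intro!: observable_intros observable_energy add_nonneg_nonneg mult_nonneg_nonneg s)
  have "(\<integral>A. exp (t * (N * (energy \<sigma> A + energy \<tau> A))) \<partial>\<mu>)
    \<le> exp (2 * N * (rom_energy t + t * \<bar>imbalance\<bar> + t\<^sup>2 * (overlap \<sigma> \<tau>)\<^sup>2))"
  proof (rule exp_moment_le[where c = "\<lambda>s. 2 * N * (rom_slope s + (\<bar>imbalance\<bar> + 2 * s * (overlap \<sigma> \<tau>)\<^sup>2))"])
    fix s :: real assume s: "0 \<le> s"
    let ?g = "\<lambda>A. exp (s * (N * (energy \<sigma> A + energy \<tau> A)))"
    let ?k = "rom_slope s + (\<bar>imbalance\<bar> + 2 * s * (overlap \<sigma> \<tau>)\<^sup>2)"
    have "(\<integral>A. (N * (energy \<sigma> A + energy \<tau> A) - 2 * N * ?k) * ?g A \<partial>\<mu>)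
      = (\<integral>A. N * ((energy \<sigma> A - ?k) * ?g A + (energy \<tau> A - ?k) * ?g A) \<partial>\<mu>)"
      by (intro Bochner_Integration.integral_cong refl) (simp add: algebra_simps)
    also have "\<dots> = N * ((\<integral>A. (energy \<sigma> A - ?k) * ?g A \<partial>\<mu>) + (\<integral>A. (energy \<tau> A - ?k) * ?g A \<partial>\<mu>))"
      unfolding integral_mult_right_zero
      by (subst Bochner_Integration.integral_add)
        (auto intro!: observable_integrable observable_intros observable_energy)
    also have "\<dots> \<le> 0"
    proof -
      have "overlap \<tau> \<sigma> = overlap \<sigma> \<tau>" by (simp add: overlap_def mult.commute)
      then have "(\<integral>A. (energy \<tau> A - ?k) * ?g A \<partial>\<mu>) \<le> 0"
        using half[OF \<tau> \<sigma> s] by (simp add: add.commute)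
      then show ?thesis using half[OF \<sigma> \<tau> s] by (intro mult_nonneg_nonpos) auto
    qed
    finally show "(\<integral>A. (N * (energy \<sigma> A + energy \<tau> A) - 2 * N * ?k) * ?g A \<partial>\<mu>) \<le> 0" .
  qed (auto intro!: observable_intros observable_energy t derivative_eq_intros DERIV_rom_energy simp: algebra_simps)
  then show ?thesis by (simp add: mult.assoc)
qed

text \<open>The square is linearised by \<open>exp_square_le_sum_exp\<close>, so every term is a
  first moment at a shifted parameter t + h. The cost F(t + h) - F(t) - h q - h^2 of the shift is
  never positive, so all terms obey one bound.\<close>

lemma annealed_square_bound:
  fixes t :: real
  assumes \<sigma>: "\<sigma> \<in> spins N" and t: "0 \<le> t"
  shows "(\<integral>A. exp (t * N * energy \<sigma> A + N / 4 * (energy \<sigma> A - rom_slope t)\<^sup>2) \<partial>\<mu>)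
    \<le> (4 * N + 1) * exp (1 / 4 + N * (rom_energy t + (t + 1) * \<bar>imbalance\<bar>))"
proof -
  let ?q = "rom_slope t" and ?K = "{- 2 * int N .. 2 * int N}"
  let ?B = "exp (N * (rom_energy t + (t + 1) * \<bar>imbalance\<bar>))"
  let ?e = "\<lambda>k A. exp (- k * ?q / 2 - k\<^sup>2 / (4 * N)) * exp ((t + k / (2 * N)) * N * energy \<sigma> A)"
  have int: "integrable \<mu> (?e k)" for k :: real
    by (auto intro!: observable_integrable observable_intros observable_energy)
  have k: "(\<integral>A. ?e (real_of_int k) A \<partial>\<mu>) \<le> ?B" if "k \<in> ?K" for k
  proof -
    \<comment> \<open>The shift of the inverse temperature carried by the k-th term. The range of k
      gives |h| <= 1, whence the factor t + 1 of the imbalance.\<close>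
    define h where "h = real_of_int k / (2 * N)"
    have k: "real_of_int k = 2 * N * h" using N_pos by (simp add: h_def)
    have "\<bar>real_of_int k\<bar> \<le> 2 * N" using that by auto
    then have h1: "\<bar>h\<bar> \<le> 1" using N_pos by (simp add: h_def)
    have "(\<integral>A. ?e (real_of_int k) A \<partial>\<mu>)
      = exp (- (N * h * ?q) - N * h\<^sup>2) * (\<integral>A. exp ((t + h) * N * energy \<sigma> A) \<partial>\<mu>)"
      using N_pos by (simp add: k power2_eq_square mult_ac)
    also have "\<dots> \<le> exp (- (N * h * ?q) - N * h\<^sup>2) * exp (N * (rom_energy (t + h) + \<bar>t + h\<bar> * \<bar>imbalance\<bar>))"
      by (intro mult_left_mono annealed_bound \<sigma>) simp
    also have "\<dots> = exp (N * (rom_energy (t + h) + \<bar>t + h\<bar> * \<bar>imbalance\<bar> - h * ?q - h\<^sup>2))"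
      by (simp add: algebra_simps flip: exp_add)
    also have "\<dots> \<le> ?B"
    proof -
      have "\<bar>t + h\<bar> * \<bar>imbalance\<bar> \<le> (t + 1) * \<bar>imbalance\<bar>"
        using t h1 by (intro mult_right_mono) auto
      then have "rom_energy (t + h) + \<bar>t + h\<bar> * \<bar>imbalance\<bar> - h * ?q - h\<^sup>2 \<le> rom_energy t + (t + 1) * \<bar>imbalance\<bar>"
        using rom_energy_le_quadratic[of t h] by linarith
      then show ?thesis by (simp add: mult_left_mono)
    qed
    finally show ?thesis .
  qed
  have "(\<integral>A. exp (t * N * energy \<sigma> A + N / 4 * (energy \<sigma> A - ?q)\<^sup>2) \<partial>\<mu>)
    \<le> (\<integral>A. exp (1 / 4) * (\<Sum>k\<in>?K. ?e (real_of_int k) A) \<partial>\<mu>)"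
  proof (rule integral_mono)
    fix A assume "A \<in> space \<mu>"
    then have "\<bar>energy \<sigma> A - ?q\<bar> \<le> 2"
      using abs_energy_le_1[OF _ \<sigma>, of A] abs_rom_slope_le_1[of t] by auto
    from exp_square_le_sum_exp[OF _ this N_pos, of "1 / 4"]
    have "exp (N / 4 * (energy \<sigma> A - ?q)\<^sup>2) \<le> exp (1 / 4) *
        (\<Sum>k\<in>?K. exp (k * (energy \<sigma> A - ?q) / 2 - (real_of_int k)\<^sup>2 / (4 * N)))"
      by simp
    from mult_left_mono[OF this, of "exp (t * N * energy \<sigma> A)"]
    have "exp (t * N * energy \<sigma> A + N / 4 * (energy \<sigma> A - ?q)\<^sup>2) \<le> exp (1 / 4) *
        (\<Sum>k\<in>?K. exp (t * N * energy \<sigma> A) * exp (k * (energy \<sigma> A - ?q) / 2 - (real_of_int k)\<^sup>2 / (4 * N)))"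
      by (simp add: exp_add mult.left_commute flip: sum_distrib_left)
    also have "(\<Sum>k\<in>?K. exp (t * N * energy \<sigma> A) * exp (k * (energy \<sigma> A - ?q) / 2 - (real_of_int k)\<^sup>2 / (4 * N)))
        = (\<Sum>k\<in>?K. ?e (real_of_int k) A)"
      unfolding exp_add[symmetric] using N_pos
      by (intro sum.cong refl arg_cong[of _ _ exp]) (simp add: field_simps)
    finally show "exp (t * N * energy \<sigma> A + N / 4 * (energy \<sigma> A - ?q)\<^sup>2) \<le> exp (1 / 4) * (\<Sum>k\<in>?K. ?e (real_of_int k) A)" .
  qed (auto intro!: observable_integrable observable_intros observable_energy)
  also have "\<dots> = exp (1 / 4) * (\<Sum>k\<in>?K. (\<integral>A. ?e (real_of_int k) A \<partial>\<mu>))"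
    using int by simp
  also have "\<dots> \<le> exp (1 / 4) * (\<Sum>k\<in>?K. ?B)"
    by (intro mult_left_mono sum_mono k) auto
  also have "\<dots> = (4 * N + 1) * exp (1 / 4 + N * (rom_energy t + (t + 1) * \<bar>imbalance\<bar>))"
    by (simp add: exp_add)
  finally show ?thesis .
qed

text \<open>For uniform tau, N r is a sum of N independent signs, so E exp (k r) = cosh (k / N)^N is
  at most exp (k^2 / (2 N)). This is exactly the Gaussian factor that linearisation with coefficient
  1/2 subtracts.\<close>

lemma overlap_moment_bound:
  assumes \<sigma>: "\<sigma> \<in> spins N"
  shows "(\<Sum>\<tau>\<in>spins N. exp (N / 2 * (overlap \<sigma> \<tau>)\<^sup>2)) \<le> (4 * N + 1) * exp (1 / 2) * 2 ^ N"
proof -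
  let ?K = "{- 2 * int N .. 2 * int N}"
  have k: "(\<Sum>\<tau>\<in>spins N. exp (k * overlap \<sigma> \<tau> - k\<^sup>2 / (2 * N))) \<le> 2 ^ N" for k :: real
  proof -
    have "(\<Sum>\<tau>\<in>spins N. exp (k * overlap \<sigma> \<tau>)) = (\<Sum>\<tau>\<in>spins N. \<Prod>a<N. exp (k / N * \<sigma> $ a * \<tau> $ a))"
      unfolding overlap_def exp_sum[OF finite_lessThan, symmetric]
      by (simp add: sum_distrib_left sum_divide_distrib mult_ac)
    also have "\<dots> = (\<Prod>a<N. exp (k / N * \<sigma> $ a * (- 1)) + exp (k / N * \<sigma> $ a * 1))"
      by (rule sum_spins_prod)
    also have "\<dots> = (\<Prod>a<N. 2 * cosh (k / N))"
    proof (intro prod.cong refl)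
      fix a assume "a \<in> {..<N}"
      then have "\<sigma> $ a = 1 \<or> \<sigma> $ a = - 1" using \<sigma> unfolding spins_def by auto
      then show "exp (k / N * \<sigma> $ a * (- 1)) + exp (k / N * \<sigma> $ a * 1) = 2 * cosh (k / N)"
        by (auto simp: cosh_field_def)
    qed
    also have "\<dots> = 2 ^ N * cosh (k / N) ^ N" by (simp add: power_mult_distrib)
    also have "\<dots> \<le> 2 ^ N * exp ((k / N)\<^sup>2 / 2) ^ N"
      by (intro mult_left_mono power_mono cosh_le_exp_half_square) auto
    also have "exp ((k / N)\<^sup>2 / 2) ^ N = exp (k\<^sup>2 / (2 * N))"
      using N_pos by (simp add: power2_eq_square flip: exp_of_nat_mult)
    finally show ?thesis
      by (simp add: exp_diff divide_le_eq flip: sum_divide_distrib)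
  qed
  have "(\<Sum>\<tau>\<in>spins N. exp (N / 2 * (overlap \<sigma> \<tau>)\<^sup>2))
     \<le> (\<Sum>\<tau>\<in>spins N. exp (1 / 2) * (\<Sum>k\<in>?K. exp (real_of_int k * overlap \<sigma> \<tau> - (real_of_int k)\<^sup>2 / (2 * N))))"
  proof (rule sum_mono)
    fix \<tau> assume "\<tau> \<in> spins N"
    then have "\<bar>overlap \<sigma> \<tau>\<bar> \<le> 2" using abs_overlap_le_1[OF \<sigma>, of \<tau>] by simp
    from exp_square_le_sum_exp[OF _ this N_pos, of "1 / 2"]
    show "exp (N / 2 * (overlap \<sigma> \<tau>)\<^sup>2) \<le> exp (1 / 2) * (\<Sum>k\<in>?K. exp (real_of_int k * overlap \<sigma> \<tau> - (real_of_int k)\<^sup>2 / (2 * N)))"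
      by simp
  qed
  also have "\<dots> = exp (1 / 2) * (\<Sum>k\<in>?K. \<Sum>\<tau>\<in>spins N. exp (real_of_int k * overlap \<sigma> \<tau> - (real_of_int k)\<^sup>2 / (2 * N)))"
    by (subst sum.swap) (simp add: sum_distrib_left)
  also have "\<dots> \<le> exp (1 / 2) * (\<Sum>k\<in>?K. 2 ^ N)"
    by (intro mult_left_mono sum_mono k) auto
  also have "\<dots> = (4 * N + 1) * exp (1 / 2) * 2 ^ N" by simp
  finally show ?thesis .
qed

section \<open>The quenched free energy\<close>

definition mean_partition :: "real \<Rightarrow> real mat \<Rightarrow> real" where
  "mean_partition t A = partition_sum t A / 2 ^ N"

definition free_energy :: "real \<Rightarrow> real" where
  "free_energy t = (\<integral>A. ln (mean_partition t A) \<partial>\<mu>) / N"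

lemma mean_partition_pos: "0 < mean_partition t A"
  by (simp add: mean_partition_def partition_sum_pos)

text \<open>Energies lie in [-1, 1], so the normalised partition sum lies between exp (- |t| N) and
  exp (|t| N); this gives both bounds on the logarithm.\<close>

lemma observable_ln_mean_partition: "observable (\<lambda>A. ln (mean_partition t A))"
proof -
  have "\<bar>ln (mean_partition t A)\<bar> \<le> \<bar>t\<bar> * N" if A: "A \<in> orth" for A
  proof -
    have b: "\<bar>t * N * energy \<sigma> A\<bar> \<le> \<bar>t\<bar> * N" if "\<sigma> \<in> spins N" for \<sigma>
      using abs_energy_le_1[OF A that] N_pos by (simp add: abs_mult mult_left_le)
    have "partition_sum t A \<le> (\<Sum>\<sigma>\<in>spins N. exp (\<bar>t\<bar> * N))"
      unfolding partition_sum_def using b by (intro sum_mono) (auto simp: abs_le_iff)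
    then have "mean_partition t A \<le> exp (\<bar>t\<bar> * N)"
      by (simp add: mean_partition_def card_spins divide_le_eq mult.commute)
    then have u: "ln (mean_partition t A) \<le> \<bar>t\<bar> * N"
      using mean_partition_pos[of t A] by (metis exp_gt_zero ln_exp ln_le_cancel_iff)
    have "(\<Sum>\<sigma>\<in>spins N. exp (- (\<bar>t\<bar> * N))) \<le> partition_sum t A"
      unfolding partition_sum_def
    proof (rule sum_mono)
      fix \<sigma> assume "\<sigma> \<in> spins N"
      from b[OF this] show "exp (- (\<bar>t\<bar> * N)) \<le> exp (t * N * energy \<sigma> A)"
        unfolding exp_le_cancel_iff by linarith
    qed
    then have "exp (- (\<bar>t\<bar> * N)) \<le> mean_partition t A"
      by (simp add: mean_partition_def card_spins le_divide_eq mult.commute)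
    then have "- (\<bar>t\<bar> * N) \<le> ln (mean_partition t A)"
      using mean_partition_pos[of t A] by (simp add: ln_ge_iff)
    with u show ?thesis by (simp add: abs_le_iff)
  qed
  moreover have "(\<lambda>A. ln (mean_partition t A)) \<in> borel_measurable \<mu>"
    unfolding mean_partition_def using observable_partition_sum[of t] by (auto dest!: observable_measurable)
  ultimately show ?thesis unfolding observable_def by blast
qed

lemma DERIV_free_energy:
  "(free_energy has_real_derivative (\<integral>A. (\<Sum>\<sigma>\<in>spins N. gibbs t A \<sigma> * energy \<sigma> A) \<partial>\<mu>)) (at t)"
proof -
  let ?m = "\<lambda>t A. \<Sum>\<sigma>\<in>spins N. gibbs t A \<sigma> * energy \<sigma> A"
  have D: "((\<lambda>s. ln (mean_partition s A)) has_real_derivative N * ?m s A) (at s)" for s A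
  proof -
    have "((\<lambda>s. partition_sum s A) has_real_derivative (\<Sum>\<sigma>\<in>spins N. exp (s * N * energy \<sigma> A) * (N * energy \<sigma> A))) (at s)"
      unfolding partition_sum_def by (intro DERIV_sum) (auto intro!: derivative_eq_intros)
    moreover have "(\<Sum>\<sigma>\<in>spins N. exp (s * N * energy \<sigma> A) * (N * energy \<sigma> A)) = partition_sum s A * (N * ?m s A)"
      unfolding gibbs_def sum_distrib_left using partition_sum_pos[of s A] by (simp add: mult_ac)
    ultimately show ?thesis
      unfolding mean_partition_def using partition_sum_pos[of s A]
      by (auto intro!: derivative_eq_intros)
  qed
  have C: "\<bar>N * ?m s A\<bar> \<le> N" if A: "A \<in> orth" for s A
  proof -
    have "\<bar>?m s A\<bar> \<le> (\<Sum>\<sigma>\<in>spins N. \<bar>gibbs s A \<sigma> * energy \<sigma> A\<bar>)" by (rule sum_abs)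
    also have "\<dots> \<le> (\<Sum>\<sigma>\<in>spins N. gibbs s A \<sigma>)"
      using abs_energy_le_1[OF A] gibbs_nonneg[of s A]
      by (intro sum_mono) (auto simp: abs_mult intro: mult_left_le)
    finally show ?thesis using N_pos by (simp add: sum_gibbs abs_mult)
  qed
  have "((\<lambda>t. \<integral>A. ln (mean_partition t A) \<partial>\<mu>) has_real_derivative (\<integral>A. N * ?m t A \<partial>\<mu>)) (at t)"
  proof (rule DERIV_expectation[where e = 1 and C = "real N" and h = "\<lambda>t A. ln (mean_partition t A)"
        and h' = "\<lambda>t A. N * ?m t A"])
    show "(\<lambda>A. N * ?m t A) \<in> borel_measurable \<mu>"
      by (auto intro!: observable_measurable observable_intros observable_gibbs observable_energy)
  qed (use D C in \<open>auto intro: observable_integrable observable_ln_mean_partition\<close>)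
  then have "((\<lambda>t. (\<integral>A. ln (mean_partition t A) \<partial>\<mu>) / N) has_real_derivative (\<integral>A. N * ?m t A \<partial>\<mu>) / N) (at t)"
    by (rule DERIV_cdivide)
  then show ?thesis using N_pos by (simp add: free_energy_def[abs_def])
qed

text \<open>Jensen's inequality is used twice, under the Gibbs measure and under the Haar measure.
  The first leaves - ln Z, whose mean is - N p; with N F from \<open>annealed_square_bound\<close>
  this forms the gap.\<close>

lemma quenched_energy_fluctuation:
  fixes t :: real
  assumes t: "0 \<le> t"
  shows "N / 4 * (\<integral>A. (\<Sum>\<sigma>\<in>spins N. gibbs t A \<sigma> * (energy \<sigma> A - rom_slope t)\<^sup>2) \<partial>\<mu>)
    \<le> ln (4 * N + 1) + 1 / 4 + N * (rom_energy t - free_energy t + (t + 1) * \<bar>imbalance\<bar>)"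
proof -
  let ?a = "\<lambda>\<sigma> A. N / 4 * (energy \<sigma> A - rom_slope t)\<^sup>2"
  let ?u = "\<lambda>A. (\<Sum>\<sigma>\<in>spins N. exp (t * N * energy \<sigma> A + ?a \<sigma> A)) / 2 ^ N"
  let ?f = "\<lambda>A. (\<Sum>\<sigma>\<in>spins N. gibbs t A \<sigma> * ?a \<sigma> A)"
  let ?B = "exp (1 / 4 + N * (rom_energy t + (t + 1) * \<bar>imbalance\<bar>))"
  have obs: "observable ?f"
    by (auto intro!: observable_intros observable_gibbs observable_energy)
  have S: "0 < (\<Sum>\<sigma>\<in>spins N. exp (t * N * energy \<sigma> A + ?a \<sigma> A))" for A
    using finite_spins spins_nonempty by (intro sum_pos) auto
  have "(\<integral>A. ?f A + ln (mean_partition t A) \<partial>\<mu>) \<le> ln (\<integral>A. ?u A \<partial>\<mu>)"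
  proof (rule integral_le_ln_integral)
    fix A
    show "0 < ?u A" using S[of A] by simp
    have "?f A \<le> ln (\<Sum>\<sigma>\<in>spins N. exp (t * N * energy \<sigma> A + ?a \<sigma> A)) - ln (partition_sum t A)"
      using gibbs_mean_le_ln[OF finite_spins spins_nonempty, of "\<lambda>\<sigma>. t * N * energy \<sigma> A" "\<lambda>\<sigma>. ?a \<sigma> A"]
      unfolding gibbs_def partition_sum_def .
    then show "?f A + ln (mean_partition t A) \<le> ln (?u A)"
      using S[of A] partition_sum_pos[of t A] by (simp add: mean_partition_def ln_div)
  qed (auto intro!: observable_integrable observable_intros observable_gibbs observable_energy observable_ln_mean_partition)
  also have "\<dots> \<le> ln ((4 * N + 1) * ?B)"
  proof -
    have "(\<integral>A. ?u A \<partial>\<mu>) = (\<Sum>\<sigma>\<in>spins N. (\<integral>A. exp (t * N * energy \<sigma> A + ?a \<sigma> A) \<partial>\<mu>)) / 2 ^ N"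
      by (simp, subst Bochner_Integration.integral_sum)
        (auto intro!: observable_integrable observable_intros observable_energy)
    also have "\<dots> \<le> (\<Sum>\<sigma>\<in>spins N. (4 * N + 1) * ?B) / 2 ^ N"
      by (intro divide_right_mono sum_mono annealed_square_bound t) auto
    also have "\<dots> = (4 * N + 1) * ?B" by (simp add: card_spins)
    finally have le: "(\<integral>A. ?u A \<partial>\<mu>) \<le> (4 * N + 1) * ?B" .
    have "0 < (\<integral>A. ?u A \<partial>\<mu>)"
      using S by (intro expectation_pos observable_integrable observable_intros observable_energy) simp
    with le show ?thesis by simp
  qed
  also have "\<dots> = ln (4 * N + 1) + (1 / 4 + N * (rom_energy t + (t + 1) * \<bar>imbalance\<bar>))"
    by (subst ln_mult) auto
  also have "(\<integral>A. ?f A + ln (mean_partition t A) \<partial>\<mu>) = (\<integral>A. ?f A \<partial>\<mu>) + N * free_energy t"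
    using N_pos observable_integrable[OF obs] observable_integrable[OF observable_ln_mean_partition]
    by (simp add: free_energy_def)
  also have "(\<integral>A. ?f A \<partial>\<mu>) = N / 4 * (\<integral>A. (\<Sum>\<sigma>\<in>spins N. gibbs t A \<sigma> * (energy \<sigma> A - rom_slope t)\<^sup>2) \<partial>\<mu>)"
    unfolding integral_mult_right_zero[symmetric] sum_distrib_left
    by (intro Bochner_Integration.integral_cong sum.cong refl) (simp add: mult_ac)
  finally show ?thesis by (simp add: algebra_simps)
qed

text \<open>The same double use of Jensen's inequality for pairs of configurations; the two copies
  of - ln Z account for the factor 2 in front of the gap.\<close>

lemma quenched_overlap_bound:
  fixes t :: real
  assumes t: "0 \<le> t" "t \<le> 1 / 3"
  shows "N / 4 * (\<integral>A. (\<Sum>\<sigma>\<in>spins N. \<Sum>\<tau>\<in>spins N. gibbs t A \<sigma> * gibbs t A \<tau> * (overlap \<sigma> \<tau>)\<^sup>2) \<partial>\<mu>)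
    \<le> ln (4 * N + 1) + 1 / 2 + 2 * N * (rom_energy t - free_energy t + t * \<bar>imbalance\<bar>)"
proof -
  let ?a = "\<lambda>(\<sigma>, \<tau>). N / 4 * (overlap \<sigma> \<tau>)\<^sup>2"
  let ?e = "\<lambda>(\<sigma>, \<tau>). \<lambda>A. t * N * (energy \<sigma> A + energy \<tau> A)"
  let ?J = "spins N \<times> spins N"
  let ?u = "\<lambda>A. (\<Sum>j\<in>?J. exp (?e j A + ?a j)) / 4 ^ N"
  let ?f = "\<lambda>A. (\<Sum>\<sigma>\<in>spins N. \<Sum>\<tau>\<in>spins N. gibbs t A \<sigma> * gibbs t A \<tau> * (N / 4 * (overlap \<sigma> \<tau>)\<^sup>2))"
  let ?c = "2 * N * (rom_energy t + t * \<bar>imbalance\<bar>)"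
  have J: "finite ?J" "?J \<noteq> {}" using finite_spins spins_nonempty by auto
  have obs: "observable ?f"
    by (auto intro!: observable_intros observable_gibbs observable_energy)
  have obs_u: "observable (\<lambda>A. exp (?e j A + ?a j))" for j
    by (cases j) (auto intro!: observable_intros observable_energy)
  have obs_U: "observable ?u"
    by (intro observable_divide_const observable_sum obs_u)
  have S: "0 < (\<Sum>j\<in>?J. exp (?e j A + ?a j))" for A
    using J by (intro sum_pos) auto
  have Z: "(\<Sum>j\<in>?J. exp (?e j A)) = (partition_sum t A)\<^sup>2" for A
    unfolding partition_sum_def power2_eq_square sum_product sum.cartesian_product
    by (intro sum.cong refl) (auto simp: distrib_left simp flip: exp_add)
  have "(\<integral>A. ?f A + 2 * ln (mean_partition t A) \<partial>\<mu>) \<le> ln (\<integral>A. ?u A \<partial>\<mu>)"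
  proof (rule integral_le_ln_integral)
    fix A
    show "0 < ?u A" using S[of A] by simp
    have "?f A = (\<Sum>j\<in>?J. exp (?e j A) / (\<Sum>i\<in>?J. exp (?e i A)) * ?a j)"
      unfolding Z sum.cartesian_product gibbs_def
      by (intro sum.cong refl) (auto simp: power2_eq_square distrib_left exp_add)
    also have "\<dots> \<le> ln (\<Sum>j\<in>?J. exp (?e j A + ?a j)) - ln (\<Sum>j\<in>?J. exp (?e j A))"
      by (rule gibbs_mean_le_ln[OF J])
    finally have "?f A \<le> ln (\<Sum>j\<in>?J. exp (?e j A + ?a j)) - 2 * ln (partition_sum t A)"
      unfolding Z using partition_sum_pos[of t A] by (simp add: ln_realpow)
    moreover have "ln (4 ^ N :: real) = 2 * ln (2 ^ N)"
      using ln_realpow[of "2 ^ N :: real" 2] by (simp flip: power_mult power_mult_distrib add: power2_eq_square)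
    ultimately show "?f A + 2 * ln (mean_partition t A) \<le> ln (?u A)"
      using S[of A] partition_sum_pos[of t A] by (simp add: mean_partition_def ln_div)
  qed (intro observable_integrable observable_add obs observable_mult observable_const observable_ln_mean_partition obs_U)+
  also have "\<dots> \<le> ln ((4 * N + 1) * exp (1 / 2 + ?c))"
  proof -
    have "(\<integral>A. ?u A \<partial>\<mu>) = (\<Sum>j\<in>?J. (\<integral>A. exp (?e j A + ?a j) \<partial>\<mu>)) / 4 ^ N"
      unfolding integral_divide_zero
      by (intro arg_cong2[where f = "(/)"] refl Bochner_Integration.integral_sum observable_integrable obs_u)
    also have "\<dots> \<le> (\<Sum>(\<sigma>, \<tau>)\<in>?J. exp ?c * exp (N / 2 * (overlap \<sigma> \<tau>)\<^sup>2)) / 4 ^ N"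
    proof (intro divide_right_mono sum_mono)
      fix j assume "j \<in> ?J"
      then obtain \<sigma> \<tau> where j: "j = (\<sigma>, \<tau>)" and \<sigma>: "\<sigma> \<in> spins N" and \<tau>: "\<tau> \<in> spins N" by blast
      let ?r = "(overlap \<sigma> \<tau>)\<^sup>2"
      have "(\<integral>A. exp (?e j A + ?a j) \<partial>\<mu>) = exp (N / 4 * ?r) * (\<integral>A. exp (t * N * (energy \<sigma> A + energy \<tau> A)) \<partial>\<mu>)"
        by (simp add: j exp_add mult.commute)
      also have "\<dots> \<le> exp (N / 4 * ?r) * exp (2 * N * (rom_energy t + t * \<bar>imbalance\<bar> + t\<^sup>2 * ?r))"
        by (intro mult_left_mono annealed_pair_bound \<sigma> \<tau> t) simp
      also have "\<dots> = exp ?c * exp (N * ((1 / 4 + 2 * t\<^sup>2) * ?r))"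
        by (simp add: algebra_simps flip: exp_add)
      also have "\<dots> \<le> exp ?c * exp (N / 2 * ?r)"
      proof -
        \<comment> \<open>The weight 1/4 and the coupling 2 t^2 together must stay within the
          coefficient 1/2 of \<open>overlap_moment_bound\<close>; at t = 1/3 their sum is
          17/36.\<close>
        have "t\<^sup>2 \<le> (1 / 3)\<^sup>2" using t by (intro power_mono) auto
        then have "1 / 4 + 2 * t\<^sup>2 \<le> 1 / 2" by (simp add: power2_eq_square)
        then have "N * ((1 / 4 + 2 * t\<^sup>2) * ?r) \<le> N * (1 / 2 * ?r)"
          by (intro mult_left_mono mult_right_mono) auto
        then show ?thesis by simp
      qed
      finally show "(\<integral>A. exp (?e j A + ?a j) \<partial>\<mu>) \<le> (case j of (\<sigma>, \<tau>) \<Rightarrow> exp ?c * exp (N / 2 * (overlap \<sigma> \<tau>)\<^sup>2))"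
        by (simp add: j)
    qed simp
    also have "\<dots> = exp ?c * (\<Sum>\<sigma>\<in>spins N. \<Sum>\<tau>\<in>spins N. exp (N / 2 * (overlap \<sigma> \<tau>)\<^sup>2)) / 4 ^ N"
      by (simp add: sum_distrib_left flip: sum.cartesian_product)
    also have "\<dots> \<le> exp ?c * (\<Sum>\<sigma>\<in>spins N. (4 * N + 1) * exp (1 / 2) * 2 ^ N) / 4 ^ N"
      by (intro divide_right_mono mult_left_mono sum_mono overlap_moment_bound) auto
    also have "\<dots> = (4 * N + 1) * exp (1 / 2 + ?c)"
    proof -
      have "(4 :: real) ^ N = 2 ^ N * 2 ^ N" by (simp flip: power_mult_distrib)
      then show ?thesis by (simp add: card_spins exp_add)
    qed
    finally have le: "(\<integral>A. ?u A \<partial>\<mu>) \<le> (4 * N + 1) * exp (1 / 2 + ?c)" .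
    have "0 < (\<integral>A. ?u A \<partial>\<mu>)"
      using S by (intro expectation_pos observable_integrable obs_U) simp
    with le show ?thesis by simp
  qed
  also have "\<dots> = ln (4 * N + 1) + (1 / 2 + ?c)"
    by (subst ln_mult) auto
  also have "(\<integral>A. ?f A + 2 * ln (mean_partition t A) \<partial>\<mu>) = (\<integral>A. ?f A \<partial>\<mu>) + 2 * N * free_energy t"
    using N_pos observable_integrable[OF obs] observable_integrable[OF observable_ln_mean_partition]
    by (simp add: free_energy_def)
  also have "(\<integral>A. ?f A \<partial>\<mu>) = N / 4 * (\<integral>A. (\<Sum>\<sigma>\<in>spins N. \<Sum>\<tau>\<in>spins N. gibbs t A \<sigma> * gibbs t A \<tau> * (overlap \<sigma> \<tau>)\<^sup>2) \<partial>\<mu>)"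
    unfolding integral_mult_right_zero[symmetric] sum_distrib_left
    by (intro Bochner_Integration.integral_cong sum.cong refl) (simp add: mult_ac)
  finally show ?thesis by (simp add: algebra_simps)
qed

text \<open>Multiplying the sum of the two fluctuation bounds by 2 t <= 2/3 gives 16/3 |imbalance|
  and (16/3 ln (4 N + 1) + 2) / N. With the further |imbalance| from the quenched identity, the
  coefficients 19/3 and 16/3 are rounded up to 7 and 6.\<close>

definition error_rate :: real where
  "error_rate = 7 * \<bar>imbalance\<bar> + (6 * ln (4 * N + 1) + 2) / N"

text \<open>The factor 8 is 2/3 * 4 * (1 + 2): the bound 2 t <= 2/3, the inverse of the weight 1/4,
  and one gap from the energy fluctuation plus two from the overlap.\<close>

lemma free_energy_derivative_bound:
  fixes t :: real
  assumes t: "0 \<le> t" "t \<le> 1 / 3"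
  shows "rom_slope t - (\<integral>A. (\<Sum>\<sigma>\<in>spins N. gibbs t A \<sigma> * energy \<sigma> A) \<partial>\<mu>)
    \<le> 8 * (rom_energy t - free_energy t) + error_rate"
proof -
  let ?q = "rom_slope t" and ?p = "\<lambda>A \<sigma>. gibbs t A \<sigma>"
  let ?y = "\<lambda>A. \<Sum>\<sigma>\<in>spins N. ?p A \<sigma> * (energy \<sigma> A - ?q)"
  let ?y2 = "\<lambda>A. \<Sum>\<sigma>\<in>spins N. ?p A \<sigma> * (energy \<sigma> A - ?q)\<^sup>2"
  let ?r2 = "\<lambda>A. \<Sum>\<sigma>\<in>spins N. \<Sum>\<tau>\<in>spins N. ?p A \<sigma> * ?p A \<tau> * (overlap \<sigma> \<tau>)\<^sup>2"
  define Y where "Y = (\<integral>A. ?y A \<partial>\<mu>)"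
  define Y2 where "Y2 = (\<integral>A. ?y2 A \<partial>\<mu>)"
  define R2 where "R2 = (\<integral>A. ?r2 A \<partial>\<mu>)"
  define m where "m = 1 + 4 * (t * ?q)"
  have m: "1 \<le> m" using rom_slope_sign[of t] by (simp add: m_def)
  have int: "integrable \<mu> ?y" "integrable \<mu> ?y2" "integrable \<mu> ?r2"
    by (auto intro!: observable_integrable observable_intros observable_gibbs observable_energy)
  have nonneg: "0 \<le> Y2" "0 \<le> R2"
    unfolding Y2_def R2_def by (auto intro!: Bochner_Integration.integral_nonneg sum_nonneg mult_nonneg_nonneg gibbs_nonneg)
  have "0 \<le> (\<integral>A. m * ?y A + 2 * t * ?y2 A + \<bar>imbalance\<bar> + 2 * t * ?r2 A \<partial>\<mu>)"
  proof -
    let ?I = "\<lambda>A. (\<Sum>\<sigma>\<in>spins N. ?p A \<sigma> * (imbalance - energy \<sigma> A + 2 * t * (1 - (energy \<sigma> A)\<^sup>2)))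
     - 2 * t * (\<Sum>\<sigma>\<in>spins N. \<Sum>\<tau>\<in>spins N. ?p A \<sigma> * ?p A \<tau> * ((overlap \<sigma> \<tau>)\<^sup>2 - (cross_energy \<sigma> \<tau> A)\<^sup>2))"
    have "0 = (\<integral>A. - ?I A \<partial>\<mu>)"
      using quenched_identity[of t] by (simp only: Bochner_Integration.integral_minus minus_zero)
    also have "\<dots> \<le> (\<integral>A. m * ?y A + 2 * t * ?y2 A + \<bar>imbalance\<bar> + 2 * t * ?r2 A \<partial>\<mu>)"
    proof (rule integral_mono)
      fix A
      have 1: "imbalance - x + 2 * t * (1 - x\<^sup>2) = imbalance - m * (x - ?q) - 2 * t * (x - ?q)\<^sup>2" for x
        using rom_drift[of x t] unfolding m_def by (simp add: algebra_simps)
      have "(\<Sum>\<sigma>\<in>spins N. ?p A \<sigma> * (imbalance - energy \<sigma> A + 2 * t * (1 - (energy \<sigma> A)\<^sup>2)))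
        = (\<Sum>\<sigma>\<in>spins N. ?p A \<sigma>) * imbalance - m * ?y A - 2 * t * ?y2 A"
        unfolding 1 sum_distrib_left sum_distrib_right sum_subtractf[symmetric]
        by (intro sum.cong refl) (simp add: algebra_simps)
      moreover have "(\<Sum>\<sigma>\<in>spins N. \<Sum>\<tau>\<in>spins N. ?p A \<sigma> * ?p A \<tau> * ((overlap \<sigma> \<tau>)\<^sup>2 - (cross_energy \<sigma> \<tau> A)\<^sup>2)) \<le> ?r2 A"
        by (intro sum_mono mult_left_mono mult_nonneg_nonneg gibbs_nonneg) simp
      then have "2 * t * (\<Sum>\<sigma>\<in>spins N. \<Sum>\<tau>\<in>spins N. ?p A \<sigma> * ?p A \<tau> * ((overlap \<sigma> \<tau>)\<^sup>2 - (cross_energy \<sigma> \<tau> A)\<^sup>2)) \<le> 2 * t * ?r2 A"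
        using t by (intro mult_left_mono) auto
      ultimately show "- ?I A \<le> m * ?y A + 2 * t * ?y2 A + \<bar>imbalance\<bar> + 2 * t * ?r2 A"
        unfolding sum_gibbs by linarith
    qed (auto intro!: observable_integrable observable_intros observable_gibbs observable_energy observable_cross_energy)
    finally show ?thesis .
  qed
  also have "\<dots> = m * Y + 2 * t * Y2 + \<bar>imbalance\<bar> + 2 * t * R2"
    unfolding Y_def Y2_def R2_def using int by (simp add: prob_space)
  finally have mY: "- (\<bar>imbalance\<bar> + 2 * t * (Y2 + R2)) \<le> m * Y" by (simp add: algebra_simps)
  have k: "0 \<le> \<bar>imbalance\<bar> + 2 * t * (Y2 + R2)" using nonneg t by simp
  \<comment> \<open>Only a negative Y needs an argument: then m Y <= Y because m >= 1.\<close>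
  have Y_le: "- Y \<le> \<bar>imbalance\<bar> + 2 * t * (Y2 + R2)"
  proof (cases "0 \<le> Y")
    case False
    then have "m * Y \<le> 1 * Y" using m by (intro mult_right_mono_neg) auto
    then show ?thesis using mY by linarith
  qed (use k in linarith)
  have "2 * t * (Y2 + R2) \<le> 2 / 3 * (Y2 + R2)"
    using t nonneg by (intro mult_right_mono) auto
  moreover have "N * (Y2 + R2) \<le> 4 * (2 * ln (4 * N + 1) + 3 / 4 + 3 * N * (rom_energy t - free_energy t)
      + N * ((3 * t + 1) * \<bar>imbalance\<bar>))"
    using quenched_energy_fluctuation[OF t(1)] quenched_overlap_bound[OF t]
    unfolding Y2_def[symmetric] R2_def[symmetric] by (simp add: algebra_simps)
  then have "Y2 + R2 \<le> 4 * (2 * ln (4 * N + 1) + 3 / 4) / N + 12 * (rom_energy t - free_energy t)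
      + 4 * ((3 * t + 1) * \<bar>imbalance\<bar>)"
    using N_pos by (simp add: field_simps)
  moreover have "(3 * t + 1) * \<bar>imbalance\<bar> \<le> 2 * \<bar>imbalance\<bar>"
    using t by (intro mult_right_mono) auto
  moreover have "2 / 3 * (4 * (2 * ln (4 * N + 1) + 3 / 4) / N) \<le> (6 * ln (4 * N + 1) + 2) / N"
  proof -
    have "2 / 3 * (4 * (2 * ln (4 * real N + 1) + 3 / 4)) \<le> 6 * ln (4 * real N + 1) + 2" by simp
    from divide_right_mono[OF this, of N] show ?thesis by (simp add: add.commute)
  qed
  ultimately have "- Y \<le> 8 * (rom_energy t - free_energy t) + error_rate"
    unfolding error_rate_def using Y_le by argo
  moreover have "Y = (\<integral>A. (\<Sum>\<sigma>\<in>spins N. gibbs t A \<sigma> * energy \<sigma> A) \<partial>\<mu>) - ?q"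
  proof -
    have "?y A = (\<Sum>\<sigma>\<in>spins N. gibbs t A \<sigma> * energy \<sigma> A) - ?q" for A
      by (simp add: right_diff_distrib sum_subtractf sum_gibbs flip: sum_distrib_right)
    then show ?thesis unfolding Y_def
      by (simp add: prob_space observable_integrable observable_intros observable_gibbs observable_energy)
  qed
  ultimately show ?thesis by simp
qed

lemma error_rate_nonneg: "0 \<le> error_rate"
  unfolding error_rate_def by simp

text \<open>The gap vanishes at 0 and satisfies a linear differential inequality up to
  \<open>error_rate\<close>, which stays a prefactor and therefore carries the smallness.\<close>

lemma free_energy_lower_bound:
  fixes t :: real
  assumes t: "0 \<le> t" "t \<le> 1 / 3"
  shows "rom_energy t - free_energy t \<le> error_rate * t * exp (8 * t)"
proof (rule gronwall_affine)
  fix s assume s: "0 \<le> s" "s \<le> t"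
  show "((\<lambda>t. rom_energy t - free_energy t) has_real_derivative
      rom_slope s - (\<integral>A. (\<Sum>\<sigma>\<in>spins N. gibbs s A \<sigma> * energy \<sigma> A) \<partial>\<mu>)) (at s)"
    by (intro DERIV_diff DERIV_rom_energy DERIV_free_energy)
  show "rom_slope s - (\<integral>A. (\<Sum>\<sigma>\<in>spins N. gibbs s A \<sigma> * energy \<sigma> A) \<partial>\<mu>)
      \<le> 8 * (rom_energy s - free_energy s) + error_rate"
    using s t by (intro free_energy_derivative_bound) auto
next
  show "rom_energy 0 - free_energy 0 = 0"
    by (simp add: free_energy_def mean_partition_def partition_sum_def card_spins)
qed (use t error_rate_nonneg in auto)

lemma expectation_mean_partition:
  fixes t :: real
  assumes "0 \<le> t"
  shows "(\<integral>A. mean_partition t A \<partial>\<mu>) \<le> exp (N * (rom_energy t + t * \<bar>imbalance\<bar>))"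
proof -
  have "(\<integral>A. mean_partition t A \<partial>\<mu>) = (\<Sum>\<sigma>\<in>spins N. (\<integral>A. exp (t * N * energy \<sigma> A) \<partial>\<mu>)) / 2 ^ N"
    unfolding mean_partition_def partition_sum_def
    by (simp, subst Bochner_Integration.integral_sum)
      (auto intro!: observable_integrable observable_intros observable_energy)
  also have "\<dots> \<le> (\<Sum>\<sigma>\<in>spins N. exp (N * (rom_energy t + t * \<bar>imbalance\<bar>))) / 2 ^ N"
    using annealed_bound[of _ t] assms by (intro divide_right_mono sum_mono) auto
  finally show ?thesis by (simp add: card_spins)
qed

lemma free_energy_deviation:
  fixes t :: real
  assumes t: "0 \<le> t" "t \<le> 1 / 3"
  shows "(\<integral>A. \<bar>1 / N * ln (mean_partition t A) - rom_energy t\<bar> \<partial>\<mu>)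
    \<le> 2 / N + 2 * t * \<bar>imbalance\<bar> + error_rate * t * exp (8 * t)"
proof -
  let ?F = "rom_energy t + t * \<bar>imbalance\<bar>" and ?Y = "\<lambda>A. 1 / N * ln (mean_partition t A)"
  have obs: "observable ?Y" "observable (mean_partition t)"
    unfolding mean_partition_def[abs_def]
    by (intro observable_intros observable_ln_mean_partition[unfolded mean_partition_def] observable_partition_sum)+
  have int: "integrable \<mu> ?Y" "integrable \<mu> (mean_partition t)"
    using obs by (auto intro: observable_integrable)
  have "(\<integral>A. \<bar>?Y A - rom_energy t\<bar> \<partial>\<mu>)
      \<le> (\<integral>A. 2 / N * (mean_partition t A * exp (- (N * ?F))) - (?Y A - rom_energy t) + 2 * t * \<bar>imbalance\<bar> \<partial>\<mu>)"
  proof (rule integral_mono)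
    fix A
    define z where "z = ?Y A - ?F"
    have "mean_partition t A = exp (N * ?Y A)"
      using N_pos mean_partition_pos[of t A] by simp
    then have e: "mean_partition t A * exp (- (N * ?F)) = exp (N * z)"
      by (simp add: z_def right_diff_distrib exp_diff exp_minus divide_inverse)
    have "N * z \<le> exp (N * z)" using exp_ge_add_one_self[of "N * z"] by linarith
    then have "z \<le> exp (N * z) / N" using N_pos by (simp add: field_simps)
    moreover have "0 \<le> exp (N * z) / N" by simp
    \<comment> \<open>Here |z| = 2 max (z, 0) - z, and the positive part is at most exp (N z) / N.
      The mean of exp (N z) is at most 1 by the annealed bound, and the mean of - z is controlled by
      the lower bound on p.\<close>
    ultimately have "\<bar>z\<bar> \<le> 2 * (exp (N * z) / N) - z" by linarith
    moreover have "\<bar>?Y A - rom_energy t\<bar> \<le> \<bar>z\<bar> + t * \<bar>imbalance\<bar>"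
    proof -
      have "?Y A - rom_energy t = z + t * \<bar>imbalance\<bar>" by (simp add: z_def)
      then show ?thesis using t by (simp add: abs_triangle_ineq[THEN order_trans] abs_mult)
    qed
    ultimately have "\<bar>?Y A - rom_energy t\<bar> \<le> 2 * (exp (N * z) / N) - z + t * \<bar>imbalance\<bar>" by linarith
    then show "\<bar>?Y A - rom_energy t\<bar>
      \<le> 2 / N * (mean_partition t A * exp (- (N * ?F))) - (?Y A - rom_energy t) + 2 * t * \<bar>imbalance\<bar>"
      unfolding e by (simp add: z_def)
  qed (use int in auto)
  also have "\<dots> = 2 / N * ((\<integral>A. mean_partition t A \<partial>\<mu>) * exp (- (N * ?F))) - (free_energy t - rom_energy t) + 2 * t * \<bar>imbalance\<bar>"
    using int by (simp add: prob_space free_energy_def)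
  also have "\<dots> \<le> 2 / N * 1 + error_rate * t * exp (8 * t) + 2 * t * \<bar>imbalance\<bar>"
  proof -
    have "(\<integral>A. mean_partition t A \<partial>\<mu>) * exp (- (N * ?F)) \<le> exp (N * ?F) * exp (- (N * ?F))"
      by (intro mult_right_mono expectation_mean_partition t) simp
    also have "\<dots> = 1" by (simp flip: exp_add)
    finally have "2 / N * ((\<integral>A. mean_partition t A \<partial>\<mu>) * exp (- (N * ?F))) \<le> 2 / N * 1"
      by (intro mult_left_mono) auto
    then show ?thesis using free_energy_lower_bound[OF t] by linarith
  qed
  finally show ?thesis by simp
qed

section \<open>Transfer to the partition function and Markov's inequality\<close>

lemma partition_function_eq:
  assumes A: "A \<in> orth"
  shows "partition_function N t A (mat_diag N d) = mean_partition t A"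
proof -
  have c: "A \<in> carrier_mat N N" using A by (rule orthogonal_carrier)
  have "\<sigma> \<bullet> ((A * mat_diag N d * A\<^sup>T) *\<^sub>v \<sigma>) = N * energy \<sigma> A" if "\<sigma> \<in> spins N" for \<sigma>
  proof -
    have s: "\<sigma> \<in> carrier_vec N" using that by (simp add: spins_def)
    have D: "mat_diag N d \<in> carrier_mat N N" by simp
    let ?z = "A\<^sup>T *\<^sub>v \<sigma>"
    have z: "?z \<in> carrier_vec N" using c s by auto
    have zi: "?z $ i = proj \<sigma> A i" if "i < N" for i
      using c s that by (simp add: scalar_prod_def proj_def atLeast0LessThan mult.commute)
    have Dz: "(mat_diag N d *\<^sub>v ?z) $ i = d i * proj \<sigma> A i" if "i < N" for i
      using mat_diag_mult_vec_index[OF z that] zi[OF that] by simp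
    have "(A * mat_diag N d * A\<^sup>T) *\<^sub>v \<sigma> = A *\<^sub>v (mat_diag N d *\<^sub>v ?z)"
      using c s D z by (simp add: assoc_mult_mat_vec[of _ N N _ N])
    moreover have "(A *\<^sub>v w) $ a = (\<Sum>i<N. A $$ (a, i) * w $ i)" if "w \<in> carrier_vec N" "a < N" for w a
      using c that by (simp add: scalar_prod_def atLeast0LessThan)
    ultimately have field: "((A * mat_diag N d * A\<^sup>T) *\<^sub>v \<sigma>) $ a = local_field \<sigma> A a" if "a < N" for a
      using mult_mat_vec_carrier[OF D z] Dz that by (simp add: local_field_def mult_ac)
    have "\<sigma> \<bullet> w = (\<Sum>a<N. \<sigma> $ a * w $ a)" if "w \<in> carrier_vec N" for w
      using that by (simp add: scalar_prod_def atLeast0LessThan)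
    moreover have "(A * mat_diag N d * A\<^sup>T) *\<^sub>v \<sigma> \<in> carrier_vec N"
      using c D s by (intro mult_mat_vec_carrier[of _ N N]) auto
    ultimately have "\<sigma> \<bullet> ((A * mat_diag N d * A\<^sup>T) *\<^sub>v \<sigma>) = (\<Sum>a<N. \<sigma> $ a * local_field \<sigma> A a)"
      using field by simp
    then show ?thesis by (simp add: sum_spin_field energy_def)
  qed
  then show ?thesis
    unfolding partition_function_def mean_partition_def partition_sum_def by (simp add: mult.assoc)
qed

lemma deviation_probability:
  fixes t :: real
  assumes t: "0 \<le> t" "t \<le> 1 / 3" and e: "0 < e"
  shows "measure \<mu> {A \<in> orth. \<bar>1 / N * ln (mean_partition t A) - rom_energy t\<bar> > e}
    \<le> (2 / N + 2 * t * \<bar>imbalance\<bar> + error_rate * t * exp (8 * t)) / e"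
proof -
  let ?z = "\<lambda>A. \<bar>1 / N * ln (mean_partition t A) - rom_energy t\<bar>"
  have "integrable \<mu> (\<lambda>A. 1 / N * ln (mean_partition t A) - rom_energy t)"
    by (intro observable_integrable observable_intros observable_ln_mean_partition)
  then have int: "integrable \<mu> ?z" by (rule integrable_abs)
  then have [measurable]: "?z \<in> borel_measurable \<mu>" by simp
  have "{A \<in> space \<mu>. e \<le> ?z A} \<in> sets \<mu>" by measurable
  then have "measure \<mu> {A \<in> orth. ?z A > e} \<le> measure \<mu> {A \<in> space \<mu>. e \<le> ?z A}"
    by (intro finite_measure_mono) auto
  also have "\<dots> \<le> (\<integral>A. ?z A \<partial>\<mu>) / e"
    using int e sets.top[of \<mu>] by (intro integral_Markov_inequality_measure[where A = "{}"]) auto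
  also have "\<dots> \<le> (2 / N + 2 * t * \<bar>imbalance\<bar> + error_rate * t * exp (8 * t)) / e"
    using e by (intro divide_right_mono free_energy_deviation t) simp
  finally show ?thesis .
qed

end

section \<open>Vanishing of the imbalance and convergence in probability\<close>

lemma imbalance_tendsto_0:
  fixes d :: "nat \<Rightarrow> nat \<Rightarrow> real"
  assumes sign: "\<And>N i. i < N \<Longrightarrow> d N i \<in> {-1, 1}"
    and weak: "weak_conv_m (\<lambda>N. empirical_measure N (d N)) symmetric_sign_measure"
  shows "(\<lambda>N. (\<Sum>i<N. d N i) / N) \<longlonglongrightarrow> 0"
proof -
  \<comment> \<open>The point 0 lies strictly between the atoms, so the limiting distribution
    function is constant near it; its value there is the mass of -1.\<close>
  have "isCont (cdf symmetric_sign_measure) 0"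
  proof -
    have eq: "cdf symmetric_sign_measure x = 1 / 2" if "x \<in> {-1<..<1}" for x
      using that by (simp add: cdf_def measure_symmetric_sign_measure)
    have ev: "eventually (\<lambda>x. cdf symmetric_sign_measure x = 1 / 2) (nhds 0)"
      using eq by (intro eventually_nhds_in_open[THEN eventually_mono, of "{-1<..<1}"]) auto
    show ?thesis unfolding isCont_cong[OF ev] by simp
  qed
  then have "(\<lambda>N. cdf (empirical_measure N (d N)) 0) \<longlonglongrightarrow> cdf symmetric_sign_measure 0"
    using weak by (simp add: weak_conv_m_def weak_conv_def)
  then have lim: "(\<lambda>N. (\<Sum>i<N. indicator {..0} (d N i)) / N) \<longlonglongrightarrow> (1 / 2 :: real)"
    by (simp add: cdf_def measure_symmetric_sign_measure measure_empirical_measure)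
  have "(\<lambda>N. 1 - 2 * ((\<Sum>i<N. indicator {..0} (d N i)) / N)) \<longlonglongrightarrow> 1 - 2 * (1 / 2 :: real)"
    by (intro tendsto_intros lim)
  moreover have "eventually (\<lambda>N. 1 - 2 * ((\<Sum>i<N. indicator {..0} (d N i)) / N) = (\<Sum>i<N. d N i) / N) sequentially"
  proof (rule eventually_sequentiallyI)
    fix N :: nat assume "1 \<le> N"
    \<comment> \<open>On signs, d = 1 - 2 [d <= 0], which expresses the sum through the empirical
      distribution function at 0.\<close>
    have "(\<Sum>i<N. d N i) = (\<Sum>i<N. 1 - 2 * indicator {..0} (d N i))"
      by (intro sum.cong refl) (use sign in \<open>force simp: indicator_def\<close>)
    also have "\<dots> = real N - 2 * (\<Sum>i<N. indicator {..0} (d N i))"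
      by (simp add: sum_subtractf sum_distrib_left)
    finally show "1 - 2 * ((\<Sum>i<N. indicator {..0} (d N i)) / N) = (\<Sum>i<N. d N i) / N"
      using \<open>1 \<le> N\<close> by (simp add: field_simps)
  qed
  ultimately show ?thesis
    by (simp add: tendsto_cong)
qed

theorem corollary1p3:
  fixes d :: "nat \<Rightarrow> nat \<Rightarrow> real"
    and M :: "nat \<Rightarrow> 'a measure"
    and Q :: "nat \<Rightarrow> 'a \<Rightarrow> real mat"
  assumes sign: "\<And>N i. i < N \<Longrightarrow> d N i \<in> {-1, 1}"
    and weak: "weak_conv_m (\<lambda>N. empirical_measure N (d N)) symmetric_sign_measure"
    and prob: "\<And>N. prob_space (M N)"
    and haar: "\<And>N. haar_distributed N (M N) (Q N)"
  shows "\<exists>\<beta>\<^sub>0>0. \<forall>\<beta>. 0 < \<beta> \<and> \<beta> < \<beta>\<^sub>0 \<longrightarrow>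
    converges_in_prob M
      (\<lambda>N \<omega>. 1 / real N * ln (partition_function N \<beta> (Q N \<omega>) (mat_diag N (d N))))
      (1 / 4 * (sqrt (16 * \<beta>^2 + 1) + ln ((sqrt (16 * \<beta>^2 + 1) - 1) / (8 * \<beta>^2)) - 1))"
proof (intro exI[of _ "1 / 3"] conjI allI impI)
  fix \<beta> :: real assume "0 < \<beta> \<and> \<beta> < 1 / 3"
  then have \<beta>: "0 < \<beta>" "0 \<le> \<beta>" "\<beta> \<le> 1 / 3" by auto
  let ?\<mu> = "\<lambda>N. distr (M N) (orthogonal_borel N) (Q N)"
  let ?X = "\<lambda>N \<omega>. 1 / real N * ln (partition_function N \<beta> (Q N \<omega>) (mat_diag N (d N)))"
  define \<delta> where "\<delta> N = (\<Sum>i<N. d N i) / N" for N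
  \<comment> \<open>The bound of \<open>deviation_probability\<close> with \<open>error_rate\<close>
    and \<open>imbalance\<close> written out: those constants live in a locale with fixed N, whereas
    the limit varies N.\<close>
  define B where "B e N = (2 / N + 2 * \<beta> * \<bar>\<delta> N\<bar>
    + (7 * \<bar>\<delta> N\<bar> + (6 * ln (4 * N + 1) + 2) / N) * \<beta> * exp (8 * \<beta>)) / e" for e :: real and N :: nat
  have Q: "Q N \<in> measurable (M N) (orthogonal_borel N)" for N
    using haar[of N] by (simp add: haar_distributed_def)
  have loc: "haar_signs N (d N) (?\<mu> N)" if "0 < N" for N
    using that sign[of _ N] haar[of N] by unfold_locales (auto simp: haar_distributed_def)
  have "?X N \<in> borel_measurable (M N) \<and> (\<forall>e>0. measure (M N) {\<omega> \<in> space (M N). \<bar>?X N \<omega> - rom_energy \<beta>\<bar> > e} \<le> B e N)"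
    if N: "0 < N" for N
  proof -
    interpret haar_signs N "d N" "?\<mu> N" by (rule loc[OF N])
    let ?Y = "\<lambda>A. 1 / N * ln (mean_partition \<beta> A)"
    have Qorth: "Q N \<omega> \<in> orth" if "\<omega> \<in> space (M N)" for \<omega>
      using measurable_space[OF Q that] by simp
    have X: "?X N \<omega> = ?Y (Q N \<omega>)" if "\<omega> \<in> space (M N)" for \<omega>
      using partition_function_eq[OF Qorth[OF that]] by simp
    have "observable ?Y"
      by (intro observable_intros observable_ln_mean_partition)
    then have Y [measurable]: "?Y \<in> borel_measurable (orthogonal_borel N)"
      by (auto dest: observable_measurable)
    note Q [measurable]
    have "(\<lambda>\<omega>. ?Y (Q N \<omega>)) \<in> borel_measurable (M N)"
      by (rule measurable_compose[OF Q Y])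
    then have meas: "?X N \<in> borel_measurable (M N)"
      using X by (subst measurable_cong) auto
    have "measure (M N) {\<omega> \<in> space (M N). \<bar>?X N \<omega> - rom_energy \<beta>\<bar> > e} \<le> B e N" if e: "0 < e" for e
    proof -
      have "{\<omega> \<in> space (M N). \<bar>?X N \<omega> - rom_energy \<beta>\<bar> > e}
          = {\<omega> \<in> space (M N). \<bar>?Y (Q N \<omega>) - rom_energy \<beta>\<bar> > e}"
        by (intro Collect_cong conj_cong refl) (simp only: X)
      also have "\<dots> = Q N -` {A \<in> orth. \<bar>?Y A - rom_energy \<beta>\<bar> > e} \<inter> space (M N)"
        using Qorth by auto
      finally have eq: "{\<omega> \<in> space (M N). \<bar>?X N \<omega> - rom_energy \<beta>\<bar> > e}
          = Q N -` {A \<in> orth. \<bar>?Y A - rom_energy \<beta>\<bar> > e} \<inter> space (M N)" .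
      have "{A \<in> space (orthogonal_borel N). \<bar>?Y A - rom_energy \<beta>\<bar> > e} \<in> sets (orthogonal_borel N)"
        by measurable
      then have "measure (M N) {\<omega> \<in> space (M N). \<bar>?X N \<omega> - rom_energy \<beta>\<bar> > e}
          = measure (?\<mu> N) {A \<in> orth. \<bar>?Y A - rom_energy \<beta>\<bar> > e}"
        unfolding eq using Q by (subst measure_distr) auto
      also have "\<dots> \<le> B e N"
        using deviation_probability[OF \<beta>(2,3) e]
        by (simp add: B_def \<delta>_def imbalance_def error_rate_def)
      finally show ?thesis .
    qed
    with meas show ?thesis by blast
  qed
  note pos = this
  have \<delta>0: "(\<lambda>N. \<bar>\<delta> N\<bar>) \<longlonglongrightarrow> 0"
    using tendsto_rabs[OF imbalance_tendsto_0[OF sign weak]] by (simp add: \<delta>_def)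
  have l: "(\<lambda>N. (6 * ln (4 * real N + 1) + 2) / N) \<longlonglongrightarrow> 0"
    by real_asymp
  have two: "(\<lambda>N. 2 / real N) \<longlonglongrightarrow> 0" by real_asymp
  have B0: "B e \<longlonglongrightarrow> 0" if "0 < e" for e
  proof -
    have "B e \<longlonglongrightarrow> (0 + 2 * \<beta> * 0 + (7 * 0 + 0) * \<beta> * exp (8 * \<beta>)) / e"
      unfolding B_def[abs_def] using that
      by (intro tendsto_intros \<delta>0 two) (use l in \<open>simp_all add: add.commute\<close>)
    then show ?thesis by simp
  qed
  have "converges_in_prob M ?X (rom_energy \<beta>)"
    unfolding converges_in_prob_def
  proof (intro conjI allI impI)
    fix N
    \<comment> \<open>The locale requires N > 0. For N = 0 the factor \<open>1 / real N\<close> is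
      0, so the function is constant.\<close>
    show "?X N \<in> borel_measurable (M N)"
      using pos[of N] by (cases "N = 0") auto
  next
    fix e :: real assume e: "0 < e"
    show "(\<lambda>N. measure (M N) {\<omega> \<in> space (M N). \<bar>?X N \<omega> - rom_energy \<beta>\<bar> > e}) \<longlonglongrightarrow> 0"
    proof (rule tendsto_sandwich[OF _ _ tendsto_const B0[OF e]])
      show "eventually (\<lambda>N. measure (M N) {\<omega> \<in> space (M N). \<bar>?X N \<omega> - rom_energy \<beta>\<bar> > e} \<le> B e N) sequentially"
        using pos e by (intro eventually_sequentiallyI[of 1]) auto
    qed simp
  qed
  then show "converges_in_prob M ?X
      (1 / 4 * (sqrt (16 * \<beta>^2 + 1) + ln ((sqrt (16 * \<beta>^2 + 1) - 1) / (8 * \<beta>^2)) - 1))"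
    using rom_energy_eq[of \<beta>] \<beta>(1) by simp
qed simp

end
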